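(* Let $\beta>1$, let $\varepsilon\in(0,m_+)$ be irrational, and let $\eta\in(\varepsilon,m_+)$. There exist $C,\alpha>0$ such that for every $n\ge1$, every Lipschitz continuous function $f:[0,1]\to\mathbb{R}$ and every $m_0^n\in E_n^\varepsilon\cap[\eta,1]$, $$\sup_{t\ge0}\left|\mathbb{E}_{m_0^n}\left(f(m_t^n)\,\middle|\,\tau_n>t\right)-f(\overline m_t)\right|\le C\,\frac{\|f\|_\infty+\|f\|_{\mathrm{lip}}}{n^\alpha},$$ where $(\overline m_t)_{t\ge0}$ is the solution of $\frac{d}{dt}\overline m_t=(1-\overline m_t)e^{\beta\overline m_t}-(1+\overline m_t)e^{-\beta\overline m_t}$ with initial condition $\overline m_0=m_0^n$.
   Context: For $n\ge1$ let $E_n=\{-1+\frac{2i}{n}: i=0,\dots,n\}$. The (Curie-Weiss) magnetization process $(m^n_t)_{t\ge0}$ is the continuous-time Markov chain on $E_n$ jumping from $m$ to $m+\frac2n$ at rate $\lambda^n_+(m)=n\frac{1-m}{2}e^{\beta m}$ and from $m$ to $m-\frac2n$ at rate $\lambda^n_-(m)=n\frac{1+m}{2}e^{-\beta m}$. For $\beta>1$, $m_+\in(0,1)$ denotes the unique positive solution of $(1-m)e^{\beta m}=(1+m)e^{-\beta m}$. The number $\varepsilon\in(0,m_+)$ is fixed and irrational (so that $\varepsilon\notin E_n$ for all $n$); $E_n^\varepsilon=E_n\cap[\varepsilon,1]$ and $\tau_n=\inf\{t\ge0: m^n_t\le\varepsilon\}$. $\mathbb{E}_{m}$ denotes expectation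 for the chain started at $m$. $\|f\|_\infty$ and $\|f\|_{\mathrm{lip}}$ denote the supremum norm and the best Lipschitz constant of $f$ on its domain. *)

theory Defs
  imports "HOL-Probability.Probability"
begin

section \<open>Continuous-time Markov chains with finitely many states\<close>

text \<open>The transition function of jump rates \<open>q\<close>, as the solution of Kolmogorov's backward
  equation. The diagonal values \<open>q x x\<close> are irrelevant.\<close>

definition kolmogorov_backward ::
  "real set \<Rightarrow> (real \<Rightarrow> real \<Rightarrow> real) \<Rightarrow> (real \<Rightarrow> real \<Rightarrow> real \<Rightarrow> real) \<Rightarrow> bool" where
  "kolmogorov_backward S q p \<longleftrightarrow>
    (\<forall>x\<in>S. \<forall>y\<in>S. p 0 x y = of_bool (x = y)) \<and>
    (\<forall>t\<ge>0. \<forall>x\<in>S. \<forall>y\<in>S.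
      ((\<lambda>s. p s x y) has_real_derivative (\<Sum>z\<in>S. q x z * (p t z y - p t x y)))
        (at t within {0..}))"

text \<open>\<open>X\<close> is a Markov chain on \<open>S\<close> with right-continuous paths, started at \<open>x\<^sub>0\<close>,
  which jumps from \<open>x\<close> to \<open>y \<noteq> x\<close> at rate \<open>q x y\<close>. For finite \<open>S\<close> the
  function \<open>p\<close> is uniquely determined on \<open>S\<close>, and the last assumption is the
  Markov property stated through the finite-dimensional distributions.\<close>

locale jump_chain = prob_space M for M :: "'a measure" +
  fixes X :: "real \<Rightarrow> 'a \<Rightarrow> real" and S :: "real set"
    and q :: "real \<Rightarrow> real \<Rightarrow> real" and x\<^sub>0 :: real
  assumes finite_states: "finite S"
    and random_variable_X: "t \<ge> 0 \<Longrightarrow> random_variable borel (X t)"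
    and in_states: "\<omega> \<in> space M \<Longrightarrow> t \<ge> 0 \<Longrightarrow> X t \<omega> \<in> S"
    and right_continuous: "\<omega> \<in> space M \<Longrightarrow> t \<ge> 0 \<Longrightarrow> continuous (at_right t) (\<lambda>s. X s \<omega>)"
    and markov: "\<exists>p. kolmogorov_backward S q p \<and>
      (\<forall>(k::nat) (t::nat \<Rightarrow> real) x.
        t 0 = 0 \<and> (\<forall>i<k. t i \<le> t (Suc i)) \<and> (\<forall>i\<le>k. x i \<in> S) \<longrightarrow>
        prob {\<omega> \<in> space M. \<forall>i\<le>k. X (t i) \<omega> = x i} =
          of_bool (x 0 = x\<^sub>0) * (\<Prod>i<k. p (t (Suc i) - t i) (x i) (x (Suc i))))"

text \<open>The value is \<open>\<infinity>\<close> if the path never reaches \<open>{..\<epsilon>}\<close>.\<close>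

definition hitting_time_below :: "(real \<Rightarrow> 'a \<Rightarrow> real) \<Rightarrow> real \<Rightarrow> 'a \<Rightarrow> ereal" where
  "hitting_time_below X \<epsilon> \<omega> = (INF t\<in>{t. 0 \<le> t \<and> X t \<omega> \<le> \<epsilon>}. ereal t)"

text \<open>Elementary conditional expectation of \<open>Y\<close> given an event \<open>A\<close> of positive
  probability.\<close>

definition event_expectation :: "'a measure \<Rightarrow> ('a \<Rightarrow> real) \<Rightarrow> 'a set \<Rightarrow> real" where
  "event_expectation M Y A = (LINT \<omega>:A|M. Y \<omega>) / measure M A"


section \<open>The Curie--Weiss magnetization process\<close>

definition E :: "nat \<Rightarrow> real set" where
  "E n = (\<lambda>i. - 1 + 2 * real i / real n) ` {0..n}"

definition rate_plus :: "real \<Rightarrow> nat \<Rightarrow> real \<Rightarrow> real" where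
  "rate_plus \<beta> n m = real n * ((1 - m) / 2) * exp (\<beta> * m)"

definition rate_minus :: "real \<Rightarrow> nat \<Rightarrow> real \<Rightarrow> real" where
  "rate_minus \<beta> n m = real n * ((1 + m) / 2) * exp (- \<beta> * m)"

definition cw_rates :: "real \<Rightarrow> nat \<Rightarrow> real \<Rightarrow> real \<Rightarrow> real" where
  "cw_rates \<beta> n m m' =
    (if m' = m + 2 / real n then rate_plus \<beta> n m
     else if m' = m - 2 / real n then rate_minus \<beta> n m
     else 0)"

abbreviation magnetization_process ::
  "'a measure \<Rightarrow> (real \<Rightarrow> 'a \<Rightarrow> real) \<Rightarrow> real \<Rightarrow> nat \<Rightarrow> real \<Rightarrow> bool" where
  "magnetization_process M X \<beta> n m\<^sub>0 \<equiv> jump_chain M X (E n) (cw_rates \<beta> n) m\<^sub>0"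

definition cw_drift :: "real \<Rightarrow> real \<Rightarrow> real" where
  "cw_drift \<beta> m = (1 - m) * exp (\<beta> * m) - (1 + m) * exp (- \<beta> * m)"

definition cw_flow :: "real \<Rightarrow> real \<Rightarrow> (real \<Rightarrow> real) \<Rightarrow> bool" where
  "cw_flow \<beta> m\<^sub>0 \<mu> \<longleftrightarrow> \<mu> 0 = m\<^sub>0 \<and>
    (\<forall>t\<ge>0. (\<mu> has_real_derivative cw_drift \<beta> (\<mu> t)) (at t within {0..}))"

definition m_plus :: "real \<Rightarrow> real" where
  "m_plus \<beta> = (THE m. 0 < m \<and> (1 - m) * exp (\<beta> * m) = (1 + m) * exp (- \<beta> * m))"

lemma m_plus_ex1:
  fixes \<beta> :: real
  assumes "\<beta> > 1"
  shows "\<exists>!m. 0 < m \<and> (1 - m) * exp (\<beta> * m) = (1 + m) * exp (- \<beta> * m)"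
proof -
  let ?eq = "\<lambda>m::real. (1 - m) * exp (\<beta> * m) = (1 + m) * exp (- \<beta> * m)"
  have lt1: "m < 1" if "0 < m" "?eq m" for m
  proof (rule ccontr)
    assume "\<not> m < 1"
    then have "(1 - m) * exp (\<beta> * m) \<le> 0" by (simp add: mult_nonpos_nonneg)
    moreover have "(1 + m) * exp (- \<beta> * m) > 0" using that(1) by simp
    ultimately show False using that(2) by linarith
  qed
  define g where "g m = ln (1 + m) - ln (1 - m) - 2 * \<beta> * m" for m :: real
  have g0: "g 0 = 0" by (simp add: g_def)
  have groot: "g m = 0" if "0 < m" "?eq m" for m
  proof -
    have "m < 1" using lt1 that .
    then have "ln ((1 - m) * exp (\<beta> * m)) = ln (1 - m) + \<beta> * m"
      by (simp add: ln_mult)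
    moreover have "ln ((1 + m) * exp (- \<beta> * m)) = ln (1 + m) - \<beta> * m"
      using that(1) by (simp add: ln_mult)
    ultimately show ?thesis using that(2) by (simp add: g_def)
  qed
  have dg: "(g has_real_derivative 2 / (1 - m\<^sup>2) - 2 * \<beta>) (at m)" if "0 \<le> m" "m < 1" for m
  proof -
    have "(g has_real_derivative 1 / (1 + m) + 1 / (1 - m) - 2 * \<beta>) (at m)"
      unfolding g_def[abs_def] using that by (auto intro!: derivative_eq_intros)
    moreover have "1 - m\<^sup>2 = (1 + m) * (1 - m)" by (simp add: power2_eq_square algebra_simps)
    then have "1 / (1 + m) + 1 / (1 - m) = 2 / (1 - m\<^sup>2)"
      using that by (simp add: divide_simps)
    ultimately show ?thesis by simp
  qed
  have crit: "\<exists>c. a < c \<and> c < b \<and> 1 / (1 - c\<^sup>2) = \<beta>"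
    if "0 \<le> a" "a < b" "b < 1" "g a = 0" "g b = 0" for a b
  proof -
    have "\<exists>c>a. c < b \<and> g b - g a = (b - a) * (2 / (1 - c\<^sup>2) - 2 * \<beta>)"
      using that by (intro MVT2) (auto intro!: dg)
    then show ?thesis using that by auto
  qed
  have no_two: False if ab: "0 < a" "?eq a" "?eq b" "a < b" for a b
  proof -
    have "b < 1" using lt1[of b] ab by linarith
    obtain c where c: "0 < c" "c < a" "1 / (1 - c\<^sup>2) = \<beta>"
      using crit[of 0 a] groot[of a] g0 ab \<open>b < 1\<close> by auto
    obtain d where d: "a < d" "d < b" "1 / (1 - d\<^sup>2) = \<beta>"
      using crit[of a b] groot[of a] groot[of b] ab \<open>b < 1\<close> by auto
    have "inverse (1 - c\<^sup>2) = inverse (1 - d\<^sup>2)" using c d by (simp add: field_class.field_divide_inverse)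
    then have "c\<^sup>2 = d\<^sup>2" by simp
    then show False using c d by (simp add: power2_eq_iff)
  qed
  have ex: "\<exists>m. 0 < m \<and> ?eq m"
  proof -
    have "(cw_drift \<beta> has_real_derivative 2 * (\<beta> - 1)) (at 0)"
      unfolding cw_drift_def[abs_def] by (auto intro!: derivative_eq_intros)
    from DERIV_pos_inc_right[OF this] assms obtain d where
      d: "d > 0" "\<forall>h>0. h < d \<longrightarrow> cw_drift \<beta> 0 < cw_drift \<beta> (0 + h)" by auto
    define h where "h = min (d / 2) (1 / 2)"
    have h: "0 < h" "h < d" "h \<le> 1" using d(1) by (auto simp: h_def)
    have "cw_drift \<beta> h > 0" using d(2) h by (auto simp: cw_drift_def)
    moreover have "cw_drift \<beta> 1 \<le> 0" by (simp add: cw_drift_def)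
    moreover have "continuous_on {h..1} (cw_drift \<beta>)"
      unfolding cw_drift_def[abs_def] by (intro continuous_intros)
    ultimately obtain x where "h \<le> x" "x \<le> 1" "cw_drift \<beta> x = 0"
      using IVT2'[of "cw_drift \<beta>" 1 0 h] h by auto
    then show ?thesis using h by (auto simp: cw_drift_def intro!: exI[of _ x])
  qed
  then show ?thesis
    by (metis (no_types, lifting) linorder_neqE no_two)
qed


section \<open>Norms on the unit interval\<close>

definition sup_norm :: "(real \<Rightarrow> real) \<Rightarrow> real" where
  "sup_norm f = (SUP x\<in>{0..1}. \<bar>f x\<bar>)"

definition lip_norm :: "(real \<Rightarrow> real) \<Rightarrow> real" where
  "lip_norm f = Inf {L. L-lipschitz_on {0..1} f}"

end

theory Submission
  imports Defs "HOL-Real_Asymp.Real_Asymp"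
begin

text \<open>Let \<open>L\<close> be the generator of the chain killed on reaching \<open>{..\<epsilon>}\<close>. Conditioning on survival
  only involves the killed semigroup, which is the limit of the iterated Euler steps
  \<open>(1 + (t/N) L)\<^sup>N\<close>; all estimates are made for these monotone steps, by comparison with
  sub- and supersolutions.

  On \<open>[\<epsilon>, 1]\<close> the drift satisfies \<open>(x - m\<^sub>+) b(x) \<le> - a (x - m\<^sub>+)\<^sup>2\<close>. Hence the killed chain
  relaxes to \<open>m\<^sub>+\<close> in second moment, at rate \<open>2a\<close> and up to an error \<open>O(1/n)\<close>, from every
  starting point above \<open>\<epsilon>\<close>. The function \<open>1 - \<theta> powr (- n (x - \<epsilon>) / 2)\<close>, nearly harmonic for a random
  walk with upward drift, bounds the survival probability from below up to
  times of order \<open>log n\<close>, uniformly in the starting point. Up to time \<open>T = log n / (4K)\<close>, with \<open>K\<close> a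
  Lipschitz constant of the drift, Gronwall's inequality compares the chain with the flow. For
  \<open>t > T\<close> one applies the Markov property at time \<open>t - T\<close>: whatever the law of the surviving chain
  at that time, after a further time \<open>T\<close> the conditioned chain is close to \<open>m\<^sub>+\<close>, and so is the flow.\<close>


section \<open>Killed Euler steps of a finite chain\<close>

text \<open>The obstacle is uniformity in t. For fixed n nothing bounds the survival probability
  from below uniformly in t, so an absolute error cannot simply be divided by it. Beyond time
  \<open>T\<close> every estimate is therefore kept proportional to survival: the killed mean of the
  distance to \<open>m_plus \<beta>\<close> minus a small constant is shown to be nonpositive. For
  the same reason first moments are extracted from second moments by a linear inequality and not by
  a square root. The discretisation error vanishes as the number of Euler steps grows with n and t
  fixed, so no rate in the step size has to be tracked. The choice of \<open>T\<close> turns the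
  Gronwall factor exp(2KT) into n^(1/2), against a fluctuation of order 1/n, and the relaxation
  factor exp(-2aT) into n^(-a/(2K)). The smaller of the exponents 1/2 and a/(2K) controls second
  moments, and half of it is the final \<alpha>.\<close>

definition killed_step ::
  "real set \<Rightarrow> real set \<Rightarrow> (real \<Rightarrow> real \<Rightarrow> real) \<Rightarrow> real \<Rightarrow> (real \<Rightarrow> real) \<Rightarrow> real \<Rightarrow> real" where
  "killed_step S D q h g x = g x + h * (\<Sum>z\<in>S. q x z * (of_bool (z \<in> D) * g z - g x))"

definition kernel_step :: "real set \<Rightarrow> (real \<Rightarrow> real \<Rightarrow> real) \<Rightarrow> (real \<Rightarrow> real) \<Rightarrow> real \<Rightarrow> real" where
  "kernel_step D k g x = (\<Sum>z\<in>D. k x z * g z)"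

lemma killed_step_linear:
  "killed_step S D q h (\<lambda>y. a * g y + b * g' y) x =
    a * killed_step S D q h g x + b * killed_step S D q h g' x"
  by (simp add: killed_step_def algebra_simps sum.distrib sum_subtractf sum_distrib_left)

lemma killed_iterates_linear:
  "((killed_step S D q h) ^^ k) (\<lambda>y. a * g y + b * g' y) =
    (\<lambda>x. a * ((killed_step S D q h) ^^ k) g x + b * ((killed_step S D q h) ^^ k) g' x)"
  by (induction k) (auto simp: killed_step_linear)

lemma killed_iterates_uminus:
  "((killed_step S D q h) ^^ k) (\<lambda>y. - g y) = (\<lambda>x. - ((killed_step S D q h) ^^ k) g x)"
  using killed_iterates_linear[where a = "-1" and b = 0 and g = g and g' = g] by simp

text \<open>Brings the Euler step into the same form as a transition kernel restricted to
  \<open>D\<close>, so that it can be compared entry by entry with the exact kernel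
  \<open>p h\<close>.\<close>

lemma killed_step_eq_kernel_step:
  assumes "finite S" "D \<subseteq> S" "x \<in> D"
  shows "killed_step S D q h g x =
    kernel_step D (\<lambda>x y. of_bool (x = y) +
      h * (\<Sum>z\<in>S. q x z * (of_bool (z = y) - of_bool (x = y)))) g x"
proof -
  have fin: "finite D" using assms finite_subset by blast
  have pick: "(\<Sum>y\<in>D. of_bool (z = y) * g y) = of_bool (z \<in> D) * g z" for z
    using fin by (simp add: sum.delta' of_bool_def if_distrib[of "\<lambda>t. t * _"] cong: if_cong)
  define A where "A y = (\<Sum>z\<in>S. q x z * (of_bool (z = y) - of_bool (x = y)))" for y
  have "(\<Sum>y\<in>D. A y * g y) =
      (\<Sum>z\<in>S. \<Sum>y\<in>D. q x z * (of_bool (z = y) - of_bool (x = y)) * g y)"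
    unfolding A_def sum_distrib_right by (rule sum.swap)
  also have "\<dots> = (\<Sum>z\<in>S. q x z * (of_bool (z \<in> D) * g z - of_bool (x \<in> D) * g x))"
    unfolding pick[symmetric]
    by (intro sum.cong refl)
      (simp only: sum_distrib_left mult.assoc left_diff_distrib right_diff_distrib sum_subtractf)
  finally have "(\<Sum>y\<in>D. A y * g y) = (\<Sum>z\<in>S. q x z * (of_bool (z \<in> D) * g z - g x))"
    using assms(3) by simp
  moreover have "kernel_step D (\<lambda>x' y. of_bool (x = y) + h * A y) g x = g x + h * (\<Sum>y\<in>D. A y * g y)"
    using assms(3) pick[of x]
    by (simp only: kernel_step_def distrib_right sum.distrib sum_distrib_left mult.assoc) simp
  ultimately show ?thesis
    by (simp add: kernel_step_def killed_step_def A_def)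
qed

section \<open>Comparison principle for substochastic Euler steps\<close>

locale killed_chain =
  fixes S D :: "real set" and q :: "real \<Rightarrow> real \<Rightarrow> real" and \<Lambda> h :: real
  assumes finite_S: "finite S"
    and D_subset: "D \<subseteq> S"
    and q_nonneg: "x \<in> D \<Longrightarrow> z \<in> S \<Longrightarrow> 0 \<le> q x z"
    and q_sum: "x \<in> D \<Longrightarrow> (\<Sum>z\<in>S. q x z) \<le> \<Lambda>"
    and h_nonneg: "0 \<le> h"
    and h_small: "h * \<Lambda> \<le> 1"
begin

abbreviation "R \<equiv> killed_step S D q h"

text \<open>Because \<open>h * \<Lambda> \<le> 1\<close>, the diagonal coefficient
  \<open>1 - h * (\<Sum>z\<in>S. q x z)\<close> is nonnegative, as are all the others. Every later
  comparison rests on this sign.\<close>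

lemma step_mono:
  assumes "\<And>y. y \<in> D \<Longrightarrow> g y \<le> g' y" "x \<in> D"
  shows "R g x \<le> R g' x"
proof -
  have eq: "R v x = (1 - h * (\<Sum>z\<in>S. q x z)) * v x + h * (\<Sum>z\<in>S. q x z * (of_bool (z \<in> D) * v z))" for v
    by (simp add: killed_step_def algebra_simps sum_subtractf sum_distrib_left)
  have "h * (\<Sum>z\<in>S. q x z) \<le> 1"
    using mult_left_mono[OF q_sum[OF assms(2)] h_nonneg] h_small by linarith
  moreover have "(\<Sum>z\<in>S. q x z * (of_bool (z \<in> D) * g z)) \<le> (\<Sum>z\<in>S. q x z * (of_bool (z \<in> D) * g' z))"
    using assms by (intro sum_mono, intro mult_left_mono[of "of_bool _ * _"]) (auto simp: q_nonneg of_bool_def)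
  ultimately show ?thesis
    unfolding eq using assms h_nonneg by (intro add_mono mult_left_mono) auto
qed

lemma step_const_le: "0 \<le> c \<Longrightarrow> x \<in> D \<Longrightarrow> R (\<lambda>_. c) x \<le> c"
  using h_nonneg q_nonneg
  by (auto simp: killed_step_def intro!: mult_nonneg_nonpos sum_nonpos)

lemma iterates_mono:
  assumes "\<And>y. y \<in> D \<Longrightarrow> g y \<le> g' y" "x \<in> D"
  shows "(R ^^ k) g x \<le> (R ^^ k) g' x"
  using assms(2) by (induction k arbitrary: x) (auto intro: step_mono assms(1))

text \<open>A discrete Gronwall inequality for time-dependent supersolutions. The index of
  \<open>w\<close> counts steps backwards from the final time, since the innermost step of the
  iterate is the last one made by the chain. The accumulated constant is passed through a step for
  free because killing only decreases nonnegative constants.\<close>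

lemma iterates_le:
  assumes "\<And>i x. i < k \<Longrightarrow> x \<in> D \<Longrightarrow> R (w i) x \<le> r * w (Suc i) x + b"
    and "0 \<le> r" "0 \<le> b" "x \<in> D"
  shows "(R ^^ k) (w 0) x \<le> r ^ k * w k x + b * (\<Sum>i<k. r ^ i)"
  using assms(1,4)
proof (induction k arbitrary: x)
  case (Suc k)
  let ?s = "b * (\<Sum>i<k. r ^ i)"
  have s: "0 \<le> ?s" using assms by (simp add: sum_nonneg)
  have "(R ^^ Suc k) (w 0) x \<le> R (\<lambda>y. r ^ k * w k y + 1 * ?s) x"
    using Suc by (auto intro!: step_mono)
  also have "\<dots> = r ^ k * R (w k) x + R (\<lambda>_. ?s) x"
    by (subst killed_step_linear) simp
  also have "\<dots> \<le> r ^ k * (r * w (Suc k) x + b) + ?s"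
    using Suc.prems assms(2) s by (intro add_mono mult_left_mono step_const_le) auto
  finally show ?case by (simp add: algebra_simps)
qed simp

lemma iterates_abs_le:
  assumes "\<And>y. y \<in> D \<Longrightarrow> \<bar>g y\<bar> \<le> G" "x \<in> D"
  shows "\<bar>(R ^^ k) g x\<bar> \<le> G"
proof -
  have G: "0 \<le> G" using assms(1)[OF assms(2)] by linarith
  have const: "(R ^^ k) (\<lambda>_. G) x \<le> G"
    using iterates_le[of k "\<lambda>_ _. G" 1 0 x] step_const_le[OF G] assms(2) by simp
  have "(R ^^ k) g x \<le> (R ^^ k) (\<lambda>_. G) x" "(R ^^ k) (\<lambda>y. - g y) x \<le> (R ^^ k) (\<lambda>_. G) x"
    using assms by (intro iterates_mono; force)+
  then show ?thesis using const by (simp add: killed_iterates_uminus)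
qed

text \<open>Only \<open>R\<close> is known to be a contraction in the supremum norm; of
  \<open>k\<close> nothing is assumed but closeness. So the difference of the (N+1)-st iterates is
  split into \<open>R\<close> applied to the old difference, \<open>k - R\<close> applied to the old
  difference, and \<open>k - R\<close> applied to the bounded iterate of \<open>R\<close>. The
  middle term is what produces powers of \<open>1 + \<delta>\<close>.\<close>

lemma kernel_iterates_close:
  assumes close: "\<And>x. x \<in> D \<Longrightarrow> (\<Sum>y\<in>D. \<bar>k x y - (of_bool (x = y) +
      h * (\<Sum>z\<in>S. q x z * (of_bool (z = y) - of_bool (x = y))))\<bar>) \<le> \<delta>"
    and g: "\<And>y. y \<in> D \<Longrightarrow> \<bar>g y\<bar> \<le> G" and "x \<in> D"
  shows "\<bar>(kernel_step D k ^^ N) g x - (R ^^ N) g x\<bar> \<le> G * ((1 + \<delta>) ^ N - 1)"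
  using \<open>x \<in> D\<close>
proof (induction N arbitrary: x)
  case (Suc N)
  let ?K = "kernel_step D k"
  have \<delta>: "0 \<le> \<delta>" by (rule order_trans[OF _ close[OF Suc.prems]]) (simp add: sum_nonneg)
  have G: "0 \<le> G" using g[OF Suc.prems] by linarith
  have diff: "\<bar>?K v x - R v x\<bar> \<le> \<delta> * V" if v: "\<And>y. y \<in> D \<Longrightarrow> \<bar>v y\<bar> \<le> V" for v V
  proof -
    let ?e = "\<lambda>y. k x y - (of_bool (x = y) +
      h * (\<Sum>z\<in>S. q x z * (of_bool (z = y) - of_bool (x = y))))"
    have eq: "?K v x - R v x = (\<Sum>y\<in>D. ?e y * v y)"
      unfolding killed_step_eq_kernel_step[OF finite_S D_subset Suc.prems]
      by (simp only: kernel_step_def left_diff_distrib sum_subtractf)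
    have "\<bar>?K v x - R v x\<bar> \<le> (\<Sum>y\<in>D. \<bar>?e y\<bar> * V)"
      unfolding eq using v by (intro order_trans[OF sum_abs] sum_mono) (auto simp: abs_mult intro!: mult_left_mono)
    also have "\<dots> = (\<Sum>y\<in>D. \<bar>?e y\<bar>) * V" by (rule sum_distrib_right[symmetric])
    also have "\<dots> \<le> \<delta> * V"
      using v[OF Suc.prems] by (intro mult_right_mono close Suc.prems) linarith
    finally show ?thesis .
  qed
  let ?v = "\<lambda>y. (?K ^^ N) g y - (R ^^ N) g y"
  let ?V = "G * ((1 + \<delta>) ^ N - 1)"
  have V: "\<bar>?v y\<bar> \<le> ?V" if "y \<in> D" for y using Suc.IH[OF that] .
  have "\<bar>R ?v x\<bar> \<le> ?V"
    using iterates_abs_le[of ?v ?V x 1] V Suc.prems by simp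
  moreover have "\<bar>?K ?v x - R ?v x\<bar> \<le> \<delta> * ?V"
    by (rule diff) (rule V)
  moreover have "\<bar>?K ((R ^^ N) g) x - R ((R ^^ N) g) x\<bar> \<le> \<delta> * G"
    by (rule diff) (rule iterates_abs_le[OF g])
  moreover have "?K ?v x = ?K ((?K ^^ N) g) x - ?K ((R ^^ N) g) x"
    by (simp add: kernel_step_def right_diff_distrib sum_subtractf)
  ultimately have bound: "\<bar>?K ((?K ^^ N) g) x - R ((R ^^ N) g) x\<bar> \<le> ?V + \<delta> * ?V + \<delta> * G"
    by linarith
  have "?V + \<delta> * ?V + \<delta> * G = G * ((1 + \<delta>) ^ Suc N - 1)" by (simp add: algebra_simps)
  with bound show ?case by simp
qed simp

end

section \<open>Second-order expansion of the transition function at time zero\<close>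

lemma kolmogorov_backward_taylor:
  assumes "finite S" and p: "kolmogorov_backward S q p"
  obtains c where "c \<ge> 0" and "\<And>h x y. 0 \<le> h \<Longrightarrow> h \<le> 1 \<Longrightarrow> x \<in> S \<Longrightarrow> y \<in> S \<Longrightarrow>
    \<bar>p h x y - (of_bool (x = y) + h * (\<Sum>z\<in>S. q x z * (of_bool (z = y) - of_bool (x = y))))\<bar> \<le> c * h\<^sup>2"
proof -
  have p0: "p 0 x y = of_bool (x = y)" if "x \<in> S" "y \<in> S" for x y
    using p that by (simp add: kolmogorov_backward_def)
  define F where "F t x y = (\<Sum>z\<in>S. q x z * (p t z y - p t x y))" for t x y
  have der: "((\<lambda>s. p s x y) has_real_derivative F t x y) (at t within {0..})"
    if "0 \<le> t" "x \<in> S" "y \<in> S" for t x y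
    using p that by (simp add: kolmogorov_backward_def F_def)
  \<comment> \<open>The right-hand side of the backward equation is a linear combination of
    differentiable functions, so it can be differentiated once more. The second derivative is then
    continuous, hence bounded on [0,1], and two mean value estimates give the quadratic
    remainder.\<close>
  have der2: "((\<lambda>s. F s x y) has_real_derivative (\<Sum>z\<in>S. q x z * (F t z y - F t x y))) (at t within {0..})"
    if "0 \<le> t" "x \<in> S" "y \<in> S" for t x y
  proof -
    have "((\<lambda>s. \<Sum>z\<in>S. q x z * (p s z y - p s x y)) has_real_derivative
        (\<Sum>z\<in>S. q x z * (F t z y - F t x y))) (at t within {0..})"
      using that by (intro DERIV_sum DERIV_cmult DERIV_diff der) auto
    then show ?thesis by (simp only: F_def)
  qed
  have cont: "continuous_on {0..1} (\<lambda>s. F s x y)" if "x \<in> S" "y \<in> S" for x y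
    by (rule continuous_on_subset[of "{0..}"], rule DERIV_continuous_on[OF der2]) (use that in auto)
  define F2 where "F2 t x y = (\<Sum>z\<in>S. q x z * (F t z y - F t x y))" for t x y
  have "\<exists>c. \<forall>t\<in>{0..1}. \<bar>F2 t x y\<bar> \<le> c" if "x \<in> S" "y \<in> S" for x y
  proof -
    have "continuous_on {0..1} (\<lambda>s. F2 s x y)"
      unfolding F2_def using that by (intro continuous_intros cont)
    then have "bounded ((\<lambda>s. F2 s x y) ` {0..1})"
      by (intro compact_imp_bounded compact_continuous_image) auto
    then show ?thesis by (auto simp: bounded_iff)
  qed
  then obtain C where C: "\<And>x y t. x \<in> S \<Longrightarrow> y \<in> S \<Longrightarrow> t \<in> {0..1} \<Longrightarrow> \<bar>F2 t x y\<bar> \<le> C x y"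
    by metis
  define c where "c = (\<Sum>x\<in>S. \<Sum>y\<in>S. \<bar>C x y\<bar>)"
  have Cc: "C x y \<le> c" if "x \<in> S" "y \<in> S" for x y
  proof -
    have "C x y \<le> \<bar>C x y\<bar>" by simp
    also have "\<dots> \<le> (\<Sum>y\<in>S. \<bar>C x y\<bar>)"
      using that \<open>finite S\<close> by (intro member_le_sum) auto
    also have "\<dots> \<le> c" unfolding c_def
      using that \<open>finite S\<close> by (intro member_le_sum[of x S "\<lambda>x. \<Sum>y\<in>S. \<bar>C x y\<bar>"]) (auto intro: sum_nonneg)
    finally show ?thesis .
  qed
  show ?thesis
  proof
    show "c \<ge> 0" by (auto simp: c_def intro!: sum_nonneg)
    fix h x y :: real assume h: "0 \<le> h" "h \<le> 1" and xy: "x \<in> S" "y \<in> S"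
    have lip: "\<bar>F s x y - F 0 x y\<bar> \<le> c * s" if "s \<in> {0..h}" for s
    proof -
      have "norm (F s x y - F 0 x y) \<le> c * norm (s - 0)"
      proof (rule field_differentiable_bound[of "{0..h}"])
        fix t assume t: "t \<in> {0..h}"
        show "((\<lambda>s. F s x y) has_field_derivative F2 t x y) (at t within {0..h})"
          unfolding F2_def by (rule DERIV_subset[OF der2]) (use t xy in auto)
        show "norm (F2 t x y) \<le> c"
          using C[OF xy, of t] Cc[OF xy] t h by auto
      qed (use that h in auto)
      then show ?thesis using that by simp
    qed
    have "norm ((p h x y - h * F 0 x y) - (p 0 x y - 0 * F 0 x y)) \<le> (c * h) * norm (h - 0)"
    proof (rule field_differentiable_bound[of "{0..h}"])
      fix t assume t: "t \<in> {0..h}"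
      show "((\<lambda>t. p t x y - t * F 0 x y) has_field_derivative F t x y - F 0 x y) (at t within {0..h})"
        by (rule DERIV_subset[of _ _ _ "{0..}"]) (use t xy in \<open>auto intro!: derivative_eq_intros der\<close>)
      have "c * t \<le> c * h" using t \<open>c \<ge> 0\<close> by (auto intro: mult_left_mono)
      then show "norm (F t x y - F 0 x y) \<le> c * h"
        using lip[OF t] by simp
    qed (use h in auto)
    moreover have "F 0 x y = (\<Sum>z\<in>S. q x z * (of_bool (z = y) - of_bool (x = y)))"
      unfolding F_def using xy by (intro sum.cong) (auto simp: p0)
    ultimately show "\<bar>p h x y - (of_bool (x = y) + h * (\<Sum>z\<in>S. q x z * (of_bool (z = y) - of_bool (x = y))))\<bar> \<le> c * h\<^sup>2"
      using h p0[OF xy] by (simp add: power2_eq_square mult.assoc diff_diff_eq add.commute)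
  qed
qed

section \<open>Expectations on the survival event\<close>

context jump_chain
begin

text \<open>Isolates the finite-dimensional part of \<open>markov\<close>, so that one
  \<open>p\<close> can be fixed and passed to several lemmas.\<close>

definition fdd_given_by :: "(real \<Rightarrow> real \<Rightarrow> real \<Rightarrow> real) \<Rightarrow> bool" where
  "fdd_given_by p \<longleftrightarrow> (\<forall>(k::nat) (t::nat \<Rightarrow> real) x.
        t 0 = 0 \<and> (\<forall>i<k. t i \<le> t (Suc i)) \<and> (\<forall>i\<le>k. x i \<in> S) \<longrightarrow>
        prob {\<omega> \<in> space M. \<forall>i\<le>k. X (t i) \<omega> = x i} =
          of_bool (x 0 = x\<^sub>0) * (\<Prod>i<k. p (t (Suc i) - t i) (x i) (x (Suc i))))"

section \<open>Killed expectations on a time grid\<close>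

lemma measurable_state_function:
  fixes g :: "real \<Rightarrow> real"
  assumes "t \<ge> 0"
  shows "(\<lambda>\<omega>. g (X t \<omega>)) \<in> borel_measurable M"
proof -
  note [measurable] = random_variable_X[OF assms]
  have "X t \<in> measurable M (count_space S)"
    using in_states assms finite_states
    by (auto simp: measurable_count_space_eq2)
  then show ?thesis
    by (rule measurable_compose) simp
qed

lemma integrable_state_function:
  fixes g :: "real \<Rightarrow> real"
  assumes "t \<ge> 0"
  shows "integrable M (\<lambda>\<omega>. g (X t \<omega>))"
proof (rule integrable_const_bound)
  show "AE \<omega> in M. norm (g (X t \<omega>)) \<le> (\<Sum>z\<in>S. \<bar>g z\<bar>)"
    using in_states assms finite_states
    by (auto intro!: AE_I2 member_le_sum[of _ S "\<lambda>z. \<bar>g z\<bar>"])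
qed (rule measurable_state_function[OF assms])

text \<open>The generalisation that makes the induction work: the path is pinned to \<open>x\<close>
  at the first grid points and only required to lie in \<open>D\<close> at the next
  \<open>k\<close>. Splitting over the state at the first free grid point lengthens the prefix by
  one and shortens the free part; with no free part left, the claim is a finite-dimensional
  distribution.\<close>

lemma grid_expectation_prefix:
  fixes g :: "real \<Rightarrow> real"
  assumes fdd: "fdd_given_by p" and "0 \<le> h" "D \<subseteq> S" and "\<And>i. i \<le> j \<Longrightarrow> x i \<in> S"
  shows "(LINT \<omega>|M. g (X (real (j + k) * h) \<omega>) * indicator {\<omega> \<in> space M.
        (\<forall>i\<le>j. X (real i * h) \<omega> = x i) \<and> (\<forall>i\<in>{j<..j+k}. X (real i * h) \<omega> \<in> D)} \<omega>) =
      of_bool (x 0 = x\<^sub>0) * (\<Prod>i<j. p h (x i) (x (Suc i))) * (kernel_step D (p h) ^^ k) g (x j)"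
  using assms(4)
proof (induction k arbitrary: j x)
  case 0
  have "prob {\<omega> \<in> space M. \<forall>i\<le>j. X (real i * h) \<omega> = x i} =
      of_bool (x 0 = x\<^sub>0) * (\<Prod>i<j. p (real (Suc i) * h - real i * h) (x i) (x (Suc i)))"
    using fdd[unfolded fdd_given_by_def, rule_format, of "\<lambda>i. real i * h" j x] 0 \<open>0 \<le> h\<close>
    by (simp add: mult_right_mono)
  moreover have "real (Suc i) * h - real i * h = h" for i by (simp add: algebra_simps)
  moreover have "(LINT \<omega>|M. g (X (real j * h) \<omega>) *
        indicator {\<omega> \<in> space M. \<forall>i\<le>j. X (real i * h) \<omega> = x i} \<omega>) =
      (LINT \<omega>|M. g (x j) * indicator {\<omega> \<in> space M. \<forall>i\<le>j. X (real i * h) \<omega> = x i} \<omega>)"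
    by (intro Bochner_Integration.integral_cong) (auto simp: indicator_def)
  moreover have "{\<omega> \<in> space M. \<forall>i\<le>j. X (real i * h) \<omega> = x i} \<subseteq> space M" by auto
  ultimately show ?case by (simp add: Int_absorb2)
next
  case (Suc k)
  have [measurable]: "X (real i * h) \<in> borel_measurable M" for i
    using \<open>0 \<le> h\<close> by (intro random_variable_X) simp
  have fin: "finite D" using \<open>D \<subseteq> S\<close> finite_states finite_subset by blast
  then have [measurable]: "D \<in> sets borel" by (intro borel_closed finite_imp_closed)
  let ?x = "\<lambda>z. x(Suc j := z)"
  let ?I = "\<lambda>z. {\<omega> \<in> space M. (\<forall>i\<le>Suc j. X (real i * h) \<omega> = ?x z i) \<and>
    (\<forall>i\<in>{Suc j<..Suc j + k}. X (real i * h) \<omega> \<in> D)}"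
  let ?J = "{\<omega> \<in> space M. (\<forall>i\<le>j. X (real i * h) \<omega> = x i) \<and>
    (\<forall>i\<in>{j<..j + Suc k}. X (real i * h) \<omega> \<in> D)}"
  let ?g = "\<lambda>\<omega>. g (X (real (Suc j + k) * h) \<omega>)"
  have split: "indicator ?J \<omega> = (\<Sum>z\<in>D. (indicator (?I z) \<omega> :: real))" if "\<omega> \<in> space M" for \<omega>
  proof -
    have I: "\<omega> \<in> ?I z \<longleftrightarrow> z = X (real (Suc j) * h) \<omega> \<and> (\<forall>i\<le>j. X (real i * h) \<omega> = x i) \<and>
        (\<forall>i\<in>{Suc j<..Suc j + k}. X (real i * h) \<omega> \<in> D)" for z
      using that by (auto simp: le_Suc_eq)
    have "{j<..j + Suc k} = insert (Suc j) {Suc j<..Suc j + k}" by auto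
    then have "\<omega> \<in> ?J \<longleftrightarrow> X (real (Suc j) * h) \<omega> \<in> D \<and> (\<forall>i\<le>j. X (real i * h) \<omega> = x i) \<and>
        (\<forall>i\<in>{Suc j<..Suc j + k}. X (real i * h) \<omega> \<in> D)"
      using that by auto
    then show ?thesis
      unfolding indicator_def I using fin
      by (auto simp: sum.delta of_bool_conj)
  qed
  have "(LINT \<omega>|M. g (X (real (j + Suc k) * h) \<omega>) * indicator ?J \<omega>) =
      (LINT \<omega>|M. (\<Sum>z\<in>D. ?g \<omega> * indicator (?I z) \<omega>))"
    by (intro Bochner_Integration.integral_cong refl, subst split) (simp_all only: sum_distrib_left add_Suc_right add_Suc)
  also have "\<dots> = (\<Sum>z\<in>D. (LINT \<omega>|M. ?g \<omega> * indicator (?I z) \<omega>))"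
    using \<open>0 \<le> h\<close>
    by (intro Bochner_Integration.integral_sum integrable_real_mult_indicator integrable_state_function) auto
  also have "\<dots> = (\<Sum>z\<in>D. of_bool (x 0 = x\<^sub>0) * (\<Prod>i<Suc j. p h (?x z i) (?x z (Suc i))) *
      (kernel_step D (p h) ^^ k) g (?x z (Suc j)))"
    using Suc.prems \<open>D \<subseteq> S\<close> by (intro sum.cong refl, subst Suc.IH) (auto simp: le_Suc_eq)
  also have "\<dots> = (\<Sum>z\<in>D. of_bool (x 0 = x\<^sub>0) * (\<Prod>i<j. p h (x i) (x (Suc i))) *
      (p h (x j) z * (kernel_step D (p h) ^^ k) g z))"
    by (intro sum.cong refl) simp
  also have "\<dots> = of_bool (x 0 = x\<^sub>0) * (\<Prod>i<j. p h (x i) (x (Suc i))) * (kernel_step D (p h) ^^ Suc k) g (x j)"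
    by (simp only: sum_distrib_left[symmetric] funpow.simps o_apply kernel_step_def)
  finally show ?case .
qed

lemma AE_start:
  assumes "fdd_given_by p" "x\<^sub>0 \<in> S"
  shows "AE \<omega> in M. X 0 \<omega> = x\<^sub>0"
proof -
  note [measurable] = random_variable_X[of 0]
  have "prob {\<omega> \<in> space M. X 0 \<omega> = x\<^sub>0} = 1"
    using assms(1)[unfolded fdd_given_by_def, rule_format, of "\<lambda>i. 0" 0 "\<lambda>_. x\<^sub>0"] assms(2) by simp
  then show ?thesis by (subst (asm) prob_Collect_eq_1) auto
qed

lemma grid_expectation:
  fixes g :: "real \<Rightarrow> real"
  assumes fdd: "fdd_given_by p" and "0 \<le> h" "D \<subseteq> S" "x\<^sub>0 \<in> D"
  shows "(LINT \<omega>|M. g (X (real k * h) \<omega>) *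
      indicator {\<omega> \<in> space M. \<forall>i\<le>k. X (real i * h) \<omega> \<in> D} \<omega>) = (kernel_step D (p h) ^^ k) g x\<^sub>0"
proof -
  have [measurable]: "X (real i * h) \<in> borel_measurable M" for i
    using \<open>0 \<le> h\<close> by (intro random_variable_X) simp
  note [measurable] = random_variable_X[of 0]
  have "finite D" using \<open>D \<subseteq> S\<close> finite_states finite_subset by blast
  then have [measurable]: "D \<in> sets borel" by (intro borel_closed finite_imp_closed)
  have g: "(\<lambda>\<omega>. g (X (real k * h) \<omega>)) \<in> borel_measurable M"
    using \<open>0 \<le> h\<close> by (intro measurable_state_function) simp
  have "x\<^sub>0 \<in> S" using assms by auto
  have split: "(\<forall>i\<le>k. P i) \<longleftrightarrow> P 0 \<and> (\<forall>i\<in>{0<..k}. P i)" for P :: "nat \<Rightarrow> bool"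
    by (auto; metis gr0I)
  have "(LINT \<omega>|M. g (X (real k * h) \<omega>) *
      indicator {\<omega> \<in> space M. \<forall>i\<le>k. X (real i * h) \<omega> \<in> D} \<omega>) =
    (LINT \<omega>|M. g (X (real k * h) \<omega>) * indicator {\<omega> \<in> space M.
        X 0 \<omega> = x\<^sub>0 \<and> (\<forall>i\<in>{0<..k}. X (real i * h) \<omega> \<in> D)} \<omega>)"
    (is "integral\<^sup>L M ?l = integral\<^sup>L M ?r")
  proof (rule integral_cong_AE)
    show "AE \<omega> in M. ?l \<omega> = ?r \<omega>"
      using AE_start[OF fdd \<open>x\<^sub>0 \<in> S\<close>]
    proof eventually_elim
      fix \<omega> assume "X 0 \<omega> = x\<^sub>0"
      then have "(\<forall>i\<le>k. X (real i * h) \<omega> \<in> D) \<longleftrightarrow>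
          X 0 \<omega> = x\<^sub>0 \<and> (\<forall>i\<in>{0<..k}. X (real i * h) \<omega> \<in> D)"
        using \<open>x\<^sub>0 \<in> D\<close> by (subst split) simp
      then show "?l \<omega> = ?r \<omega>" by (simp add: indicator_def)
    qed
  qed (rule borel_measurable_times[OF g borel_measurable_indicator]; measurable)+
  also have "\<dots> = (kernel_step D (p h) ^^ k) g x\<^sub>0"
    using grid_expectation_prefix[OF fdd assms(2,3), of 0 "\<lambda>_. x\<^sub>0" g k] \<open>x\<^sub>0 \<in> S\<close> by simp
  finally show ?thesis .
qed

section \<open>Survival read off from fine grids\<close>

lemma less_hitting_time_iff:
  assumes "\<omega> \<in> space M" "0 \<le> t"
  shows "ereal t < hitting_time_below X \<epsilon> \<omega> \<longleftrightarrow> (\<forall>s\<in>{0..t}. \<epsilon> < X s \<omega>)"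
proof
  assume less: "ereal t < hitting_time_below X \<epsilon> \<omega>"
  show "\<forall>s\<in>{0..t}. \<epsilon> < X s \<omega>"
  proof (rule ccontr)
    assume "\<not> ?thesis"
    then obtain s where s: "0 \<le> s" "s \<le> t" "X s \<omega> \<le> \<epsilon>" by force
    then have "hitting_time_below X \<epsilon> \<omega> \<le> ereal s"
      unfolding hitting_time_below_def by (auto intro: INF_lower)
    also have "\<dots> \<le> ereal t" using s by simp
    finally show False using less by simp
  qed
next
  \<comment> \<open>Being above \<epsilon> on the closed interval only shows that the infimum is at
    least \<open>t\<close>. Right-continuity keeps the path above \<epsilon> a little beyond
    \<open>t\<close>, which makes the inequality strict.\<close>
  assume above: "\<forall>s\<in>{0..t}. \<epsilon> < X s \<omega>"
  then have "\<forall>\<^sub>F s in at_right t. \<epsilon> < X s \<omega>"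
    using right_continuous[OF assms] assms(2)
    by (auto simp: continuous_within intro: order_tendstoD)
  then obtain b where b: "b > t" "\<And>s. t < s \<Longrightarrow> s < b \<Longrightarrow> \<epsilon> < X s \<omega>"
    unfolding eventually_at_right_field by blast
  have "ereal b \<le> hitting_time_below X \<epsilon> \<omega>"
    unfolding hitting_time_below_def
  proof (rule INF_greatest)
    fix s assume "s \<in> {s. 0 \<le> s \<and> X s \<omega> \<le> \<epsilon>}"
    then show "ereal b \<le> ereal s"
      using above b(2)[of s] by (cases "s \<le> t"; cases "s < b") force+
  qed
  moreover have "ereal t < ereal b" using b by simp
  ultimately show "ereal t < hitting_time_below X \<epsilon> \<omega>" by (rule less_le_trans[rotated])
qed

text \<open>Since \<epsilon> is not a state, a path that reaches \<open>{..\<epsilon>}\<close> is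
  strictly below \<epsilon> there, and by right-continuity stays so for a positive time, which a
  fine enough grid cannot miss. A hit exactly at \<open>t\<close> leaves no room to the right but is
  seen by the last grid point.\<close>

lemma eventually_grid_survival_iff:
  assumes "\<omega> \<in> space M" "0 \<le> t" "\<epsilon> \<notin> S"
  shows "\<forall>\<^sub>F N in sequentially. (\<forall>i\<le>N. X (real i * (t / real N)) \<omega> \<in> {x \<in> S. \<epsilon> < x}) \<longleftrightarrow>
    ereal t < hitting_time_below X \<epsilon> \<omega>"
proof (cases "ereal t < hitting_time_below X \<epsilon> \<omega>")
  case True
  then have above: "\<epsilon> < X s \<omega>" if "0 \<le> s" "s \<le> t" for s
    using less_hitting_time_iff[OF assms(1,2)] that by auto
  have "X (real i * (t / real N)) \<omega> \<in> {x \<in> S. \<epsilon> < x}" if "i \<le> N" "0 < N" for i N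
  proof -
    have "real i * (t / real N) \<le> real N * (t / real N)"
      using that assms by (intro mult_right_mono) auto
    then have "real i * (t / real N) \<le> t" using that by simp
    then show ?thesis using above[of "real i * (t / real N)"] in_states[OF assms(1)] assms(2) by simp
  qed
  then show ?thesis
    using True by (intro eventually_mono[OF eventually_gt_at_top[of 0]]) auto
next
  case False
  then obtain s where s: "0 \<le> s" "s \<le> t" "X s \<omega> \<le> \<epsilon>"
    using less_hitting_time_iff[OF assms(1,2), of \<epsilon>] by force
  have "X s \<omega> \<in> S" using in_states assms s by auto
  then have lt: "X s \<omega> < \<epsilon>" using s assms by (metis order_le_less)
  have "\<forall>\<^sub>F N in sequentially. \<exists>i\<le>N. X (real i * (t / real N)) \<omega> < \<epsilon>"
  proof (cases "s = t")
    case True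
    show ?thesis
    proof (rule eventually_mono[OF eventually_gt_at_top[of 0]])
      fix N :: nat assume "0 < N"
      then show "\<exists>i\<le>N. X (real i * (t / real N)) \<omega> < \<epsilon>"
        using lt True by (intro exI[of _ N]) simp
    qed
  next
    case neq: False
    have "\<forall>\<^sub>F u in at_right s. X u \<omega> < \<epsilon>"
      using right_continuous[OF assms(1) s(1)] lt
      by (auto simp: continuous_within intro: order_tendstoD)
    then obtain b where b: "b > s" "\<And>u. s < u \<Longrightarrow> u < b \<Longrightarrow> X u \<omega> < \<epsilon>"
      unfolding eventually_at_right_field by blast
    define d where "d = min (b - s) (t - s)"
    have d: "d > 0" using b neq s by (auto simp: d_def)
    have t: "t > 0" using s neq by simp
    have "\<forall>\<^sub>F N in sequentially. t / real N < d"
      by (rule order_tendstoD[OF _ d]) (real_asymp)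
    then show ?thesis
    proof (rule eventually_elim2[OF _ eventually_gt_at_top[of 0]])
      fix N :: nat assume N: "t / real N < d" "0 < N"
      define h where "h = t / real N"
      have h: "h > 0" using t N by (simp add: h_def)
      \<comment> \<open>The first grid index strictly after \<open>s\<close>: right-continuity
        speaks about times to the right of \<open>s\<close> only.\<close>
      define i where "i = nat \<lfloor>s / h\<rfloor> + 1"
      have i: "real i = real_of_int \<lfloor>s / h\<rfloor> + 1" using h s by (simp add: i_def)
      have "s / h < real i" "real i \<le> s / h + 1" unfolding i by linarith+
      then have ih: "s < real i * h" "real i * h \<le> s + h"
        using h by (simp_all add: field_simps)
      then have "real i * h < b" "real i * h < t" using N by (auto simp: d_def h_def)
      moreover have "t = real N * h" using N by (simp add: h_def)
      ultimately have "i \<le> N" "X (real i * h) \<omega> < \<epsilon>"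
        using b(2)[of "real i * h"] ih h by auto
      then show "\<exists>i\<le>N. X (real i * (t / real N)) \<omega> < \<epsilon>" unfolding h_def by blast
    qed
  qed
  then show ?thesis
    by (rule eventually_mono) (use False in force)
qed

lemma killed_expectation_limit:
  fixes g :: "real \<Rightarrow> real"
  assumes rates: "\<And>x y. x \<in> S \<Longrightarrow> y \<in> S \<Longrightarrow> 0 \<le> q x y"
    and "0 \<le> t" "\<epsilon> \<notin> S" "\<epsilon> < x\<^sub>0" "x\<^sub>0 \<in> S"
  defines "A \<equiv> {\<omega> \<in> space M. ereal t < hitting_time_below X \<epsilon> \<omega>}"
    and "D \<equiv> {x \<in> S. \<epsilon> < x}"
  shows "A \<in> events" (is ?meas)
    and "(\<lambda>N. (killed_step S D q (t / real N) ^^ N) g x\<^sub>0) \<longlonglongrightarrow> (LINT \<omega>|M. g (X t \<omega>) * indicator A \<omega>)" (is ?lim)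
proof -
  obtain p where kolm: "kolmogorov_backward S q p" and fdd: "fdd_given_by p"
    using markov unfolding fdd_given_by_def by blast
  have "D \<subseteq> S" "x\<^sub>0 \<in> D" using assms by (auto simp: D_def)
  then have fin: "finite D" using finite_states finite_subset by blast
  then have [measurable]: "D \<in> sets borel" by (intro borel_closed finite_imp_closed)
  let ?G = "\<lambda>N. {\<omega> \<in> space M. \<forall>i\<le>N. X (real i * (t / real N)) \<omega> \<in> D}"
  have [measurable]: "X (real i * (t / real N)) \<in> borel_measurable M" for i N
    using \<open>0 \<le> t\<close> by (intro random_variable_X) simp
  have ind_lim: "(\<lambda>N. indicator (?G N) \<omega> :: real) \<longlonglongrightarrow> indicator A \<omega>" if "\<omega> \<in> space M" for \<omega>
    by (rule tendsto_eventually, rule eventually_mono[OF eventually_grid_survival_iff[OF that assms(2,3)]])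
      (use that in \<open>auto simp: indicator_def A_def D_def\<close>)
  \<comment> \<open>Survival involves uncountably many times; its measurability comes from the
    pointwise limit of the grid events.\<close>
  have ind_meas [measurable]: "(indicator A :: 'a \<Rightarrow> real) \<in> borel_measurable M"
    by (rule borel_measurable_LIMSEQ_real[OF ind_lim]) measurable
  have "{\<omega> \<in> space M. indicator A \<omega> = (1::real)} \<in> events" by measurable
  moreover have "{\<omega> \<in> space M. indicator A \<omega> = (1::real)} = A"
    by (auto simp: A_def indicator_def)
  ultimately show ?meas by simp
  have G_events: "?G N \<in> events" for N by measurable
  have int_lim: "(\<lambda>N. LINT \<omega>|M. g (X t \<omega>) * indicator (?G N) \<omega>) \<longlonglongrightarrow>
      (LINT \<omega>|M. g (X t \<omega>) * indicator A \<omega>)"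
  proof (rule integral_dominated_convergence)
    show "integrable M (\<lambda>\<omega>. \<bar>g (X t \<omega>)\<bar>)"
      by (rule integrable_state_function[OF assms(2)])
    show "AE \<omega> in M. (\<lambda>N. g (X t \<omega>) * indicator (?G N) \<omega>) \<longlonglongrightarrow> g (X t \<omega>) * indicator A \<omega>"
      by (intro AE_I2 tendsto_intros ind_lim)
    show "AE \<omega> in M. norm (g (X t \<omega>) * indicator (?G N) \<omega>) \<le> \<bar>g (X t \<omega>)\<bar>" for N
      by (rule AE_I2) (simp add: abs_mult split: split_indicator)
    show "(\<lambda>\<omega>. g (X t \<omega>) * indicator A \<omega>) \<in> borel_measurable M"
      by (rule borel_measurable_times[OF measurable_state_function[OF assms(2)] ind_meas])
    show "(\<lambda>\<omega>. g (X t \<omega>) * indicator (?G N) \<omega>) \<in> borel_measurable M" for N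
      by (rule borel_measurable_times[OF measurable_state_function[OF assms(2)] borel_measurable_indicator[OF G_events]])
  qed
  obtain c where c: "c \<ge> 0" and taylor: "\<And>h x y. 0 \<le> h \<Longrightarrow> h \<le> 1 \<Longrightarrow> x \<in> S \<Longrightarrow> y \<in> S \<Longrightarrow>
    \<bar>p h x y - (of_bool (x = y) + h * (\<Sum>z\<in>S. q x z * (of_bool (z = y) - of_bool (x = y))))\<bar> \<le> c * h\<^sup>2"
    using kolmogorov_backward_taylor[OF finite_states kolm] by blast
  define \<Lambda> where "\<Lambda> = (\<Sum>x\<in>S. \<Sum>z\<in>S. q x z)"
  define G where "G = (\<Sum>x\<in>S. \<bar>g x\<bar>)"
  \<comment> \<open>One step errs by at most \<open>C\<close> times the squared mesh
    \<open>t / N\<close>, summed over a row; over \<open>N\<close> steps the factors multiply to at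
    most \<open>exp (C * t\<^sup>2 / N)\<close>, which tends to 1.\<close>
  define C where "C = real (card D) * c"
  let ?R = "\<lambda>N. (killed_step S D q (t / real N) ^^ N) g x\<^sub>0"
  have "\<forall>\<^sub>F N in sequentially. t / real N < 1"
    by (rule order_tendstoD) (real_asymp, simp)
  moreover have "\<forall>\<^sub>F N in sequentially. t / real N * \<Lambda> < 1"
    by (rule order_tendstoD) (real_asymp, simp)
  ultimately have "\<forall>\<^sub>F N in sequentially.
      norm ((LINT \<omega>|M. g (X t \<omega>) * indicator (?G N) \<omega>) - ?R N) \<le> G * (exp (C * t\<^sup>2 / real N) - 1)"
    using eventually_gt_at_top[of 0]
  proof eventually_elim
    fix N :: nat assume N: "t / real N < 1" "t / real N * \<Lambda> < 1" "0 < N"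
    let ?h = "t / real N"
    have h: "0 \<le> ?h" using assms by simp
    interpret killed_chain S D q \<Lambda> ?h
    proof
      fix x assume x: "x \<in> D"
      then show "(\<Sum>z\<in>S. q x z) \<le> \<Lambda>" unfolding \<Lambda>_def
        using finite_states rates \<open>D \<subseteq> S\<close>
        by (intro member_le_sum[of x S "\<lambda>x. \<Sum>z\<in>S. q x z"]) (auto intro: sum_nonneg)
    qed (use finite_states \<open>D \<subseteq> S\<close> rates h N in auto)
    have "\<bar>(kernel_step D (p ?h) ^^ N) g x\<^sub>0 - ?R N\<bar> \<le> G * ((1 + C * ?h\<^sup>2) ^ N - 1)"
    proof (rule kernel_iterates_close[OF _ _ \<open>x\<^sub>0 \<in> D\<close>])
      fix x assume x: "x \<in> D"
      have "(\<Sum>y\<in>D. \<bar>p ?h x y - (of_bool (x = y) +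
          ?h * (\<Sum>z\<in>S. q x z * (of_bool (z = y) - of_bool (x = y))))\<bar>) \<le> (\<Sum>y\<in>D. c * ?h\<^sup>2)"
        using h N x \<open>D \<subseteq> S\<close> by (intro sum_mono taylor) auto
      then show "(\<Sum>y\<in>D. \<bar>p ?h x y - (of_bool (x = y) +
          ?h * (\<Sum>z\<in>S. q x z * (of_bool (z = y) - of_bool (x = y))))\<bar>) \<le> C * ?h\<^sup>2"
        by (simp add: C_def mult.assoc)
    next
      fix y assume "y \<in> D"
      then show "\<bar>g y\<bar> \<le> G"
        unfolding G_def using finite_states \<open>D \<subseteq> S\<close>
        by (intro member_le_sum[of y S "\<lambda>x. \<bar>g x\<bar>"]) auto
    qed
    also have "\<dots> \<le> G * (exp (C * t\<^sup>2 / real N) - 1)"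
    proof (intro mult_left_mono diff_mono order_refl)
      have "(1 + C * ?h\<^sup>2) ^ N \<le> exp (C * ?h\<^sup>2) ^ N"
        using c by (intro power_mono exp_ge_add_one_self) (auto simp: C_def)
      also have "\<dots> = exp (C * t\<^sup>2 / real N)"
        using N by (simp flip: exp_of_nat_mult add: power2_eq_square)
      finally show "(1 + C * ?h\<^sup>2) ^ N \<le> exp (C * t\<^sup>2 / real N)" .
    qed (auto simp: G_def intro: sum_nonneg)
    finally show "norm ((LINT \<omega>|M. g (X t \<omega>) * indicator (?G N) \<omega>) - ?R N) \<le> G * (exp (C * t\<^sup>2 / real N) - 1)"
      using grid_expectation[OF fdd h \<open>D \<subseteq> S\<close> \<open>x\<^sub>0 \<in> D\<close>, of g N] N by simp
  qed
  moreover have "(\<lambda>N. G * (exp (C * t\<^sup>2 / real N) - 1)) \<longlonglongrightarrow> 0"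
    by real_asymp
  ultimately have "(\<lambda>N. (LINT \<omega>|M. g (X t \<omega>) * indicator (?G N) \<omega>) - ?R N) \<longlonglongrightarrow> 0"
    by (rule Lim_null_comparison)
  from tendsto_diff[OF int_lim this] show ?lim by simp
qed

end

section \<open>The drift and its flow\<close>

text \<open>The sum of the bounds on [0,1] for the four terms of the derivative of the
  drift.\<close>

definition drift_lip :: "real \<Rightarrow> real" where
  "drift_lip \<beta> = exp \<beta> + \<beta> * exp \<beta> + 1 + 2 * \<beta>"

text \<open>Bounds the sum, not only the difference, of the two weights in the drift. It therefore
  controls the drift, the total jump rate and the variance of the jumps alike.\<close>

definition drift_bound :: "real \<Rightarrow> real" where
  "drift_bound \<beta> = exp \<beta> + 2"

lemma cw_drift_eq_cosh: "cw_drift \<beta> x = 2 * cosh (\<beta> * x) * (tanh (\<beta> * x) - x)"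
proof -
  have "cosh (\<beta> * x) * tanh (\<beta> * x) = sinh (\<beta> * x)"
    by (simp add: tanh_def)
  then have "2 * cosh (\<beta> * x) * (tanh (\<beta> * x) - x) = 2 * sinh (\<beta> * x) - 2 * cosh (\<beta> * x) * x"
    by (simp add: right_diff_distrib)
  moreover have "cw_drift \<beta> x = 2 * sinh (\<beta> * x) - 2 * cosh (\<beta> * x) * x"
    by (simp add: cw_drift_def sinh_field_def cosh_field_def field_simps)
  ultimately show ?thesis by simp
qed

section \<open>Bounds on the drift and its zero\<close>

lemma
  assumes "\<beta> > (0::real)" "x \<in> {0..1}"
  shows up_weight_nonneg: "0 \<le> (1 - x) * exp (\<beta> * x)"
    and up_weight_le: "(1 - x) * exp (\<beta> * x) \<le> exp \<beta>"
    and down_weight_nonneg: "0 \<le> (1 + x) * exp (- \<beta> * x)"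
    and down_weight_le: "(1 + x) * exp (- \<beta> * x) \<le> 2"
  using mult_mono[of "1 - x" 1 "exp (\<beta> * x)" "exp \<beta>"] mult_mono[of "1 + x" 2 "exp (- \<beta> * x)" 1]
    mult_left_le[of x \<beta>] assms
  by auto

lemma abs_cw_drift_le:
  assumes "\<beta> > 0" "x \<in> {0..1}"
  shows "\<bar>cw_drift \<beta> x\<bar> \<le> drift_bound \<beta>"
  using up_weight_nonneg[OF assms] up_weight_le[OF assms] down_weight_nonneg[OF assms]
    down_weight_le[OF assms]
  by (simp add: cw_drift_def drift_bound_def)

lemma cw_drift_lipschitz:
  assumes "\<beta> > 0" "x \<in> {0..1}" "y \<in> {0..1}"
  shows "\<bar>cw_drift \<beta> x - cw_drift \<beta> y\<bar> \<le> drift_lip \<beta> * \<bar>x - y\<bar>"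
proof -
  have "norm (cw_drift \<beta> x - cw_drift \<beta> y) \<le> drift_lip \<beta> * norm (x - y)"
  proof (rule field_differentiable_bound[of "{0..1}"])
    fix z :: real assume z: "z \<in> {0..1}"
    let ?d = "- exp (\<beta> * z) + \<beta> * ((1 - z) * exp (\<beta> * z)) - exp (- \<beta> * z) + \<beta> * ((1 + z) * exp (- \<beta> * z))"
    show "(cw_drift \<beta> has_field_derivative ?d) (at z within {0..1})"
      unfolding cw_drift_def[abs_def] by (auto intro!: derivative_eq_intros simp: algebra_simps)
    have "exp (\<beta> * z) \<le> exp \<beta>" "exp (- \<beta> * z) \<le> 1"
      using assms z by (auto simp: mult_left_le)
    moreover have "0 \<le> \<beta> * ((1 - z) * exp (\<beta> * z))" "\<beta> * ((1 - z) * exp (\<beta> * z)) \<le> \<beta> * exp \<beta>"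
      "0 \<le> \<beta> * ((1 + z) * exp (- \<beta> * z))" "\<beta> * ((1 + z) * exp (- \<beta> * z)) \<le> \<beta> * 2"
      using up_weight_nonneg[OF assms(1) z] up_weight_le[OF assms(1) z] down_weight_nonneg[OF assms(1) z]
        down_weight_le[OF assms(1) z] assms(1) by (auto intro: mult_left_mono)
    moreover have "0 < exp (\<beta> * z)" "0 < exp (- \<beta> * z)" by simp_all
    ultimately show "norm ?d \<le> drift_lip \<beta>"
      unfolding drift_lip_def real_norm_def abs_le_iff by linarith
  qed (use assms in auto)
  then show ?thesis by simp
qed

lemma
  assumes "\<beta> > 1"
  shows m_plus_pos: "0 < m_plus \<beta>" and m_plus_less_1: "m_plus \<beta> < 1"
    and cw_drift_m_plus: "cw_drift \<beta> (m_plus \<beta>) = 0"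
    and cw_drift_eq_0_imp: "\<And>x. 0 < x \<Longrightarrow> cw_drift \<beta> x = 0 \<Longrightarrow> x = m_plus \<beta>"
proof -
  note * = theI'[OF m_plus_ex1[OF assms], folded m_plus_def]
  then show p: "0 < m_plus \<beta>" and 0: "cw_drift \<beta> (m_plus \<beta>) = 0" by (auto simp: cw_drift_def)
  then have "m_plus \<beta> = tanh (\<beta> * m_plus \<beta>)" by (simp add: cw_drift_eq_cosh)
  then show "m_plus \<beta> < 1" using tanh_real_lt_1[of "\<beta> * m_plus \<beta>"] by simp
  show "x = m_plus \<beta>" if "0 < x" "cw_drift \<beta> x = 0" for x
    using m_plus_ex1[OF assms] * that by (auto simp: cw_drift_def)
qed

lemma concave_on_tanh_minus:
  assumes "\<beta> > (0::real)"
  shows "concave_on {0..} (\<lambda>x. tanh (\<beta> * x) - x)"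
proof (rule f''_le0_imp_concave)
  fix x :: real assume x: "x \<in> {0..}"
  have c: "cosh y \<noteq> 0" for y :: real using cosh_real_pos[of y] by linarith
  show "((\<lambda>x. tanh (\<beta> * x) - x) has_real_derivative (1 - tanh (\<beta> * x) ^ 2) * \<beta> - 1) (at x)"
    by (auto intro!: derivative_eq_intros simp: c)
  show "((\<lambda>x. (1 - tanh (\<beta> * x) ^ 2) * \<beta> - 1) has_real_derivative
      - 2 * tanh (\<beta> * x) * (1 - tanh (\<beta> * x) ^ 2) * \<beta> * \<beta>) (at x)"
    by (auto intro!: derivative_eq_intros simp: c)
  have "0 \<le> tanh (\<beta> * x)" using x assms by simp
  moreover have "tanh (\<beta> * x) ^ 2 \<le> 1"
    using tanh_real_bounds[of "\<beta> * x"] by (simp add: abs_square_le_1 abs_le_iff)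
  ultimately show "- 2 * tanh (\<beta> * x) * (1 - tanh (\<beta> * x) ^ 2) * \<beta> * \<beta> \<le> 0"
    using assms by (simp add: mult_nonneg_nonneg)
qed auto

text \<open>Up to the positive factor \<open>2 cosh (\<beta> x)\<close> the drift is the concave function
  \<open>tanh (\<beta> x) - x\<close>, so it lies above its chord through \<open>\<epsilon>\<close> and \<open>m\<^sub>+\<close> between these
  points, and below that chord to the right of \<open>m\<^sub>+\<close>.\<close>

lemma cw_drift_contracts:
  assumes "\<beta> > 1" "0 < \<epsilon>" "\<epsilon> < m_plus \<beta>"
  shows "\<exists>a>0. \<forall>x\<in>{\<epsilon>..1}. (x - m_plus \<beta>) * cw_drift \<beta> x \<le> - a * (x - m_plus \<beta>)\<^sup>2"
proof -
  define p where "p = m_plus \<beta>"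
  define f where "f x = tanh (\<beta> * x) - x" for x
  have p: "0 < p" "p < 1" "\<epsilon> < p" using m_plus_pos m_plus_less_1 assms by (auto simp: p_def)
  have conc: "concave_on {0..} f"
    using concave_on_tanh_minus[of \<beta>] assms by (simp add: f_def[abs_def])
  \<comment> \<open>Concavity in multiplied-out form, which also covers points \<open>y\<close> that
    coincide with an end of the chord.\<close>
  have chord: "(z - y) * f x + (y - x) * f z \<le> (z - x) * f y" if "0 \<le> x" "x \<le> y" "y \<le> z" "x < z" for x y z
  proof -
    define t where "t = (y - x) / (z - x)"
    have t: "0 \<le> t" "t \<le> 1" "t * (z - x) = y - x" using that by (auto simp: t_def)
    have "(1 - t) * f x + t * f z \<le> f ((1 - t) *\<^sub>R x + t *\<^sub>R z)"
      using that t by (intro concave_onD[OF conc]) auto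
    also have "(1 - t) *\<^sub>R x + t *\<^sub>R z = y"
      using t(3) by (simp add: algebra_simps)
    finally have "(z - x) * ((1 - t) * f x + t * f z) \<le> (z - x) * f y"
      using that by (intro mult_left_mono) auto
    moreover have "(z - x) * ((1 - t) * f x + t * f z) = (z - x - t * (z - x)) * f x + t * (z - x) * f z"
      by (simp add: algebra_simps)
    ultimately show ?thesis unfolding t(3) by simp
  qed
  have f0: "f 0 = 0" by (simp add: f_def)
  have fp: "f p = 0"
    using cw_drift_m_plus[OF assms(1)] by (simp add: p_def f_def cw_drift_eq_cosh)
  \<comment> \<open>The chord from 0 to \<open>p\<close> is zero at both ends, which gives the weak
    inequality; uniqueness of the positive zero makes it strict.\<close>
  have "0 \<le> p * f \<epsilon>" using chord[of 0 \<epsilon> p] p assms f0 fp by simp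
  moreover have "f \<epsilon> \<noteq> 0"
    using cw_drift_eq_0_imp[OF assms(1,2)] assms(3) by (auto simp: cw_drift_eq_cosh f_def)
  ultimately have f\<epsilon>: "0 < f \<epsilon>" using p by (auto simp: zero_le_mult_iff)
  define a where "a = f \<epsilon> / (p - \<epsilon>)"
  have a: "a > 0" using f\<epsilon> p by (simp add: a_def)
  have f: "(x - p) * f x \<le> - a * (x - p)\<^sup>2" if "x \<in> {\<epsilon>..1}" for x
  proof (cases "x \<le> p")
    case True
    have "(p - x) * f \<epsilon> \<le> (p - \<epsilon>) * f x" using chord[of \<epsilon> x p] True that p assms fp by simp
    then have "a * (p - x) \<le> f x" using p by (simp add: a_def field_simps)
    then have "(p - x) * (a * (p - x)) \<le> (p - x) * f x" using True by (intro mult_left_mono) auto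
    then show ?thesis by (simp add: power2_eq_square algebra_simps)
  next
    case False
    have "(x - p) * f \<epsilon> + (p - \<epsilon>) * f x \<le> 0" using chord[of \<epsilon> p x] False that p assms fp by simp
    then have "f x \<le> - a * (x - p)" using p by (simp add: a_def field_simps)
    then have "(x - p) * f x \<le> (x - p) * (- a * (x - p))" using False by (intro mult_left_mono) auto
    then show ?thesis by (simp add: power2_eq_square algebra_simps)
  qed
  \<comment> \<open>Here \<open>a\<close> is the absolute slope of the chord from \<epsilon> to
    \<open>p\<close>; the drift carries the additional factor \<open>2 * cosh (\<beta> * x)\<close>,
    which is at least 2.\<close>
  show ?thesis
  proof (intro exI[of _ "2 * a"] conjI ballI)
    show "2 * a > 0" using a by simp
    fix x assume x: "x \<in> {\<epsilon>..1}"
    have "1 \<le> cosh (\<beta> * x)" by (rule cosh_real_ge_1)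
    have "(x - p) * cw_drift \<beta> x = 2 * cosh (\<beta> * x) * ((x - p) * f x)"
      by (simp add: cw_drift_eq_cosh f_def)
    also have "\<dots> \<le> 2 * cosh (\<beta> * x) * (- a * (x - p)\<^sup>2)"
      using f[OF x] \<open>1 \<le> cosh (\<beta> * x)\<close> by (intro mult_left_mono) auto
    also have "\<dots> \<le> 2 * 1 * (- a * (x - p)\<^sup>2)"
      using a \<open>1 \<le> cosh (\<beta> * x)\<close> by (intro mult_right_mono_neg) auto
    finally show "(x - m_plus \<beta>) * cw_drift \<beta> x \<le> - (2 * a) * (x - m_plus \<beta>)\<^sup>2"
      by (simp add: p_def)
  qed
qed

lemma cw_drift_pos:
  assumes "\<beta> > 1" "0 < x" "x < m_plus \<beta>"
  shows "0 < cw_drift \<beta> x"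
proof -
  obtain a where a: "a > 0" "\<And>y. y \<in> {x..1} \<Longrightarrow> (y - m_plus \<beta>) * cw_drift \<beta> y \<le> - a * (y - m_plus \<beta>)\<^sup>2"
    using cw_drift_contracts[OF assms] by blast
  have "(x - m_plus \<beta>) * cw_drift \<beta> x \<le> - a * (x - m_plus \<beta>)\<^sup>2"
    using a(2)[of x] m_plus_less_1[OF assms(1)] assms by simp
  also have "\<dots> < 0" using a assms by simp
  finally show ?thesis using assms by (simp add: mult_less_0_iff)
qed

section \<open>Invariance and convergence of the flow\<close>

lemma stays_nonneg:
  fixes f :: "real \<Rightarrow> real"
  assumes der: "\<And>t. 0 \<le> t \<Longrightarrow> (f has_real_derivative f' t) (at t within {0..})"
    and "0 \<le> f 0" and boundary: "\<And>t. 0 \<le> t \<Longrightarrow> f t = 0 \<Longrightarrow> 0 < f' t" and "0 \<le> t"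
  shows "0 \<le> f t"
proof (rule ccontr)
  assume neg: "\<not> 0 \<le> f t"
  let ?Z = "{s \<in> {0..t}. 0 \<le> f s}"
  have cont: "continuous_on {0..} f" by (rule DERIV_continuous_on[OF der]) auto
  have "closed ?Z"
    by (intro continuous_on_closed_Collect_le continuous_on_subset[OF cont]) auto
  moreover have "bounded ?Z" by (rule bounded_subset[of "{0..t}"]) auto
  ultimately have "compact ?Z" by (simp add: compact_eq_bounded_closed)
  moreover have "?Z \<noteq> {}" using assms by auto
  \<comment> \<open>The last time up to \<open>t\<close> at which \<open>f\<close> is nonnegative.
    Just after it \<open>f\<close> is positive again, by continuity if \<open>f s\<close> is
    positive and by the sign of the derivative if \<open>f s\<close> is zero, against
    maximality.\<close>
  ultimately obtain s where s: "s \<in> ?Z" "\<And>u. u \<in> ?Z \<Longrightarrow> u \<le> s"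
    using compact_attains_sup[of ?Z] by blast
  have "s < t" using s(1) neg by (cases "s = t") auto
  have "\<exists>d>0. \<forall>h>0. h < d \<longrightarrow> 0 < f (s + h)"
  proof (cases "f s = 0")
    case True
    then have "0 < f' s" using s boundary by auto
    from has_real_derivative_pos_inc_right[OF der this] s(1) show ?thesis
      using True by auto
  next
    case False
    then have "0 < f s" using s by simp
    then obtain d where "d > 0" "\<And>u. u \<in> {0..} \<Longrightarrow> dist u s < d \<Longrightarrow> dist (f u) (f s) < f s"
      using cont s(1) unfolding continuous_on_iff by (metis (no_types, lifting) atLeast_iff atLeastAtMost_iff mem_Collect_eq)
    then have close: "dist (f (s + h)) (f s) < f s" if "0 < h" "h < d" for h
      using that s(1) by (simp add: dist_real_def)
    have "0 < f (s + h)" if "0 < h" "h < d" for h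
      using close[OF that] by (simp add: dist_real_def abs_less_iff)
    then show ?thesis using \<open>d > 0\<close> by blast
  qed
  then obtain d where d: "d > 0" "\<And>h. h > 0 \<Longrightarrow> h < d \<Longrightarrow> 0 < f (s + h)" by auto
  define h where "h = min (d / 2) (t - s)"
  have "h > 0" "h < d" "s + h \<le> t" using d \<open>s < t\<close> by (auto simp: h_def)
  then have "s + h \<in> ?Z" using d(2)[of h] s(1) by auto
  then show False using s(2) \<open>h > 0\<close> by force
qed

text \<open>Both ends are barriers: the drift is positive at \<epsilon>, which lies below
  \<open>m_plus \<beta>\<close>, and negative at 1, where only the downward weight is left.\<close>

lemma cw_flow_bounds:
  assumes "\<beta> > 1" "0 < \<epsilon>" "\<epsilon> < m_plus \<beta>" "cw_flow \<beta> m\<^sub>0 \<mu>" "m\<^sub>0 \<in> {\<epsilon>..1}" "0 \<le> t"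
  shows "\<mu> t \<in> {\<epsilon>..1}"
proof -
  have der: "(\<mu> has_real_derivative cw_drift \<beta> (\<mu> t)) (at t within {0..})" if "0 \<le> t" for t
    using assms(4) that by (simp add: cw_flow_def)
  have "\<mu> 0 = m\<^sub>0" using assms(4) by (simp add: cw_flow_def)
  have "0 \<le> \<mu> t - \<epsilon>"
  proof (rule stays_nonneg[of "\<lambda>t. \<mu> t - \<epsilon>" "\<lambda>t. cw_drift \<beta> (\<mu> t)"])
    fix s :: real assume s: "0 \<le> s"
    show "((\<lambda>t. \<mu> t - \<epsilon>) has_real_derivative cw_drift \<beta> (\<mu> s)) (at s within {0..})"
      using DERIV_diff[OF der[OF s] DERIV_const[of \<epsilon>]] by simp
    show "0 < cw_drift \<beta> (\<mu> s)" if "\<mu> s - \<epsilon> = 0"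
      using cw_drift_pos[OF assms(1,2,3)] that by simp
  qed (use assms \<open>\<mu> 0 = m\<^sub>0\<close> in auto)
  moreover have "0 \<le> 1 - \<mu> t"
  proof (rule stays_nonneg[of "\<lambda>t. 1 - \<mu> t" "\<lambda>t. - cw_drift \<beta> (\<mu> t)"])
    fix s :: real assume s: "0 \<le> s"
    show "((\<lambda>t. 1 - \<mu> t) has_real_derivative - cw_drift \<beta> (\<mu> s)) (at s within {0..})"
      using DERIV_diff[OF DERIV_const[of 1] der[OF s]] by simp
    show "0 < - cw_drift \<beta> (\<mu> s)" if "1 - \<mu> s = 0"
      using that by (simp add: cw_drift_def)
  qed (use assms \<open>\<mu> 0 = m\<^sub>0\<close> in auto)
  ultimately show ?thesis by simp
qed

text \<open>Contraction makes the squared distance to \<open>p\<close>, multiplied by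
  \<open>exp (2 * a * t)\<close>, nonincreasing along the flow.\<close>

lemma cw_flow_converges:
  assumes \<mu>: "cw_flow \<beta> m\<^sub>0 \<mu>" "\<And>t. 0 \<le> t \<Longrightarrow> \<mu> t \<in> I"
    and contr: "\<And>x. x \<in> I \<Longrightarrow> (x - p) * cw_drift \<beta> x \<le> - a * (x - p)\<^sup>2"
    and "0 \<le> t"
  shows "(\<mu> t - p)\<^sup>2 \<le> exp (- 2 * a * t) * (m\<^sub>0 - p)\<^sup>2"
proof -
  let ?g = "\<lambda>t. exp (2 * a * t) * (\<mu> t - p)\<^sup>2"
  let ?g' = "\<lambda>t. 2 * exp (2 * a * t) * (a * (\<mu> t - p)\<^sup>2 + (\<mu> t - p) * cw_drift \<beta> (\<mu> t))"
  have der: "(\<mu> has_real_derivative cw_drift \<beta> (\<mu> t)) (at t within {0..})" if "0 \<le> t" for t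
    using \<mu> that by (simp add: cw_flow_def)
  have der_g: "(?g has_real_derivative ?g' t) (at t within {0..})" if "0 \<le> t" for t
    using that by (auto intro!: derivative_eq_intros der simp: power2_eq_square algebra_simps)
  have "?g t \<le> ?g 0"
  proof (rule DERIV_nonpos_imp_decreasing_open[OF \<open>0 \<le> t\<close>])
    fix x assume x: "0 < x" "x < t"
    have "(?g has_real_derivative ?g' x) (at x)"
      using der_g[of x] x by (simp add: at_within_interior[of x "{0..}"])
    moreover have "?g' x \<le> 0"
      using contr[OF \<mu>(2)[of x]] x by (intro mult_nonneg_nonpos) auto
    ultimately show "\<exists>y. (?g has_real_derivative y) (at x) \<and> y \<le> 0" by blast
  next
    show "continuous_on {0..t} ?g"
      by (rule continuous_on_subset[of "{0..}"], rule DERIV_continuous_on[OF der_g]) auto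
  qed
  then have "exp (- 2 * a * t) * ?g t \<le> exp (- 2 * a * t) * ?g 0"
    by (intro mult_left_mono) auto
  then show ?thesis
    using \<mu>(1) by (simp add: cw_flow_def mult.assoc[symmetric] flip: exp_add)
qed

text \<open>The implicit Euler form, with the drift at the end of the step, is the one that fits the
  backward recursion for the chain, whose square is centred at \<open>\<mu> (s + h)\<close> before a
  step is applied.\<close>

lemma cw_flow_step:
  assumes \<beta>: "\<beta> > 0" and \<mu>: "cw_flow \<beta> m\<^sub>0 \<mu>" "\<And>t. 0 \<le> t \<Longrightarrow> \<mu> t \<in> {0..1}"
    and "0 \<le> s" "0 \<le> h"
  shows "\<bar>\<mu> (s + h) - \<mu> s - h * cw_drift \<beta> (\<mu> (s + h))\<bar> \<le> drift_lip \<beta> * drift_bound \<beta> * h\<^sup>2"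
    and "\<bar>\<mu> (s + h) - \<mu> s\<bar> \<le> drift_bound \<beta> * h"
proof -
  have der: "(\<mu> has_real_derivative cw_drift \<beta> (\<mu> t)) (at t within {s..s + h})" if "t \<in> {s..s + h}" for t
    by (rule DERIV_subset[of _ _ _ "{0..}"]) (use \<mu>(1) that \<open>0 \<le> s\<close> in \<open>auto simp: cw_flow_def\<close>)
  have lip: "\<bar>\<mu> r - \<mu> r'\<bar> \<le> drift_bound \<beta> * \<bar>r - r'\<bar>" if "r \<in> {s..s + h}" "r' \<in> {s..s + h}" for r r'
  proof -
    have "norm (\<mu> r - \<mu> r') \<le> drift_bound \<beta> * norm (r - r')"
    proof (rule field_differentiable_bound[OF _ der])
      fix t assume "t \<in> {s..s + h}"
      then show "norm (cw_drift \<beta> (\<mu> t)) \<le> drift_bound \<beta>"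
        using abs_cw_drift_le[OF \<beta> \<mu>(2)[of t]] \<open>0 \<le> s\<close> by simp
    qed (use that in auto)
    then show ?thesis by simp
  qed
  from lip[of "s + h" s] show "\<bar>\<mu> (s + h) - \<mu> s\<bar> \<le> drift_bound \<beta> * h" using \<open>0 \<le> h\<close> by simp
  have K: "0 \<le> drift_lip \<beta>" "0 \<le> drift_bound \<beta>" using \<beta> by (auto simp: drift_lip_def drift_bound_def intro!: add_nonneg_nonneg)
  let ?f = "\<lambda>r. \<mu> r - r * cw_drift \<beta> (\<mu> (s + h))"
  have "norm (?f (s + h) - ?f s) \<le> (drift_lip \<beta> * (drift_bound \<beta> * h)) * norm (s + h - s)"
  proof (rule field_differentiable_bound[of "{s..s + h}"])
    fix t assume t: "t \<in> {s..s + h}"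
    show "(?f has_field_derivative cw_drift \<beta> (\<mu> t) - cw_drift \<beta> (\<mu> (s + h))) (at t within {s..s + h})"
      using t by (auto intro!: derivative_eq_intros der)
    have "\<bar>cw_drift \<beta> (\<mu> t) - cw_drift \<beta> (\<mu> (s + h))\<bar> \<le> drift_lip \<beta> * \<bar>\<mu> t - \<mu> (s + h)\<bar>"
      using t assms by (intro cw_drift_lipschitz \<beta> \<mu>) auto
    also have "\<dots> \<le> drift_lip \<beta> * (drift_bound \<beta> * \<bar>t - (s + h)\<bar>)"
      using t \<open>0 \<le> h\<close> by (intro mult_left_mono lip K) auto
    also have "\<dots> \<le> drift_lip \<beta> * (drift_bound \<beta> * h)"
      using t K by (intro mult_left_mono) auto
    finally show "norm (cw_drift \<beta> (\<mu> t) - cw_drift \<beta> (\<mu> (s + h))) \<le> drift_lip \<beta> * (drift_bound \<beta> * h)"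
      by simp
  qed (use \<open>0 \<le> h\<close> in auto)
  then show "\<bar>\<mu> (s + h) - \<mu> s - h * cw_drift \<beta> (\<mu> (s + h))\<bar> \<le> drift_lip \<beta> * drift_bound \<beta> * h\<^sup>2"
    using \<open>0 \<le> h\<close> by (simp add: algebra_simps power2_eq_square)
qed

section \<open>Estimates for the killed Curie--Weiss chain\<close>

definition survivors :: "real \<Rightarrow> nat \<Rightarrow> real set" where
  "survivors \<epsilon> n = {x \<in> E n. \<epsilon> < x}"

definition cw_generator :: "real \<Rightarrow> nat \<Rightarrow> (real \<Rightarrow> real) \<Rightarrow> real \<Rightarrow> real" where
  "cw_generator \<beta> n g x =
    rate_plus \<beta> n x * (g (x + 2 / real n) - g x) + rate_minus \<beta> n x * (g (x - 2 / real n) - g x)"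

lemma finite_E: "finite (E n)"
  by (simp add: E_def)

lemma E_bounds: "n \<ge> 1 \<Longrightarrow> x \<in> E n \<Longrightarrow> x \<in> {-1..1}"
  by (auto simp: E_def divide_le_eq)

lemma rate_plus_nonneg: "n \<ge> 1 \<Longrightarrow> x \<in> E n \<Longrightarrow> 0 \<le> rate_plus \<beta> n x"
  using E_bounds[of n x] by (simp add: rate_plus_def)

lemma rate_minus_nonneg: "n \<ge> 1 \<Longrightarrow> x \<in> E n \<Longrightarrow> 0 \<le> rate_minus \<beta> n x"
  using E_bounds[of n x] by (simp add: rate_minus_def)

text \<open>The upward rate vanishes exactly at the right end of the grid, so the two-point formula
  for the generator holds without a boundary case.\<close>

lemma E_right_neighbour:
  assumes "n \<ge> 1" "x \<in> E n"
  shows "x + 2 / real n \<in> E n \<or> rate_plus \<beta> n x = 0"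
proof -
  obtain i where i: "i \<le> n" "x = - 1 + 2 * real i / real n" using assms by (auto simp: E_def)
  show ?thesis
  proof (cases "i = n")
    case True
    then show ?thesis using i assms by (simp add: rate_plus_def)
  next
    case False
    then have "x + 2 / real n = - 1 + 2 * real (Suc i) / real n" using i assms by (simp add: field_simps)
    then show ?thesis using i False unfolding E_def by (intro disjI1 image_eqI[of _ _ "Suc i"]) auto
  qed
qed

lemma E_left_neighbour:
  assumes "n \<ge> 1" "x \<in> E n"
  shows "x - 2 / real n \<in> E n \<or> rate_minus \<beta> n x = 0"
proof -
  obtain i where i: "i \<le> n" "x = - 1 + 2 * real i / real n" using assms by (auto simp: E_def)
  show ?thesis
  proof (cases i)
    case 0
    then show ?thesis using i by (simp add: rate_minus_def)
  next
    case (Suc j)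
    then have "x - 2 / real n = - 1 + 2 * real j / real n" using i assms by (simp add: field_simps)
    then show ?thesis using i Suc unfolding E_def by (intro disjI1 image_eqI[of _ _ j]) auto
  qed
qed

lemma sum_cw_rates:
  assumes "n \<ge> 1" "x \<in> E n"
  shows "(\<Sum>z\<in>E n. cw_rates \<beta> n x z * \<phi> z) =
    rate_plus \<beta> n x * \<phi> (x + 2 / real n) + rate_minus \<beta> n x * \<phi> (x - 2 / real n)"
proof -
  have "x + 2 / real n \<noteq> x - 2 / real n" using assms by simp
  then have "cw_rates \<beta> n x z * \<phi> z =
      (if z = x + 2 / real n then rate_plus \<beta> n x * \<phi> (x + 2 / real n) else 0) +
      (if z = x - 2 / real n then rate_minus \<beta> n x * \<phi> (x - 2 / real n) else 0)" for z
    unfolding cw_rates_def by (simp split: if_splits)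
  then show ?thesis
    using E_right_neighbour[OF assms, of \<beta>] E_left_neighbour[OF assms, of \<beta>]
    by (auto simp: sum.distrib sum.delta' finite_E)
qed

locale cw_killed =
  fixes \<beta> \<epsilon> :: real and n :: nat and h :: real
  assumes \<beta>: "\<beta> > 1" and \<epsilon>: "0 < \<epsilon>" "\<epsilon> < m_plus \<beta>" and n: "n \<ge> 1"
    and h: "0 < h" "h * (real n * drift_bound \<beta>) \<le> 1"
begin

lemma survivor_bounds:
  assumes "x \<in> survivors \<epsilon> n"
  shows "x \<in> E n" "x \<in> {\<epsilon>..1}" "x \<in> {0..1}"
  using assms E_bounds[OF n, of x] \<epsilon> by (auto simp: survivors_def)

lemma total_rate_le:
  assumes "x \<in> {0..1}"
  shows "rate_plus \<beta> n x + rate_minus \<beta> n x \<le> real n * drift_bound \<beta> / 2"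
proof -
  have "rate_plus \<beta> n x + rate_minus \<beta> n x =
      real n / 2 * ((1 - x) * exp (\<beta> * x) + (1 + x) * exp (- \<beta> * x))"
    by (simp add: rate_plus_def rate_minus_def field_simps)
  also have "\<dots> \<le> real n / 2 * drift_bound \<beta>"
    using up_weight_le[of \<beta> x] down_weight_le[of \<beta> x] assms \<beta>
    by (intro mult_left_mono) (auto simp: drift_bound_def)
  finally show ?thesis by simp
qed

lemma rate_minus_le:
  assumes "x \<in> {0..1}"
  shows "rate_minus \<beta> n x \<le> real n"
proof -
  have "rate_minus \<beta> n x = real n / 2 * ((1 + x) * exp (- \<beta> * x))"
    by (simp add: rate_minus_def)
  also have "\<dots> \<le> real n / 2 * 2"
    using down_weight_le[of \<beta> x] assms \<beta> by (intro mult_left_mono) auto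
  finally show ?thesis by simp
qed

sublocale killed_chain "E n" "survivors \<epsilon> n" "cw_rates \<beta> n" "real n * drift_bound \<beta>" h
proof
  fix x z assume x: "x \<in> survivors \<epsilon> n" and "z \<in> E n"
  show "0 \<le> cw_rates \<beta> n x z"
    using rate_plus_nonneg[OF n survivor_bounds(1)[OF x]] rate_minus_nonneg[OF n survivor_bounds(1)[OF x]]
    by (simp add: cw_rates_def)
next
  fix x assume x: "x \<in> survivors \<epsilon> n"
  have "0 \<le> real n * drift_bound \<beta>" by (simp add: drift_bound_def)
  then show "(\<Sum>z\<in>E n. cw_rates \<beta> n x z) \<le> real n * drift_bound \<beta>"
    using sum_cw_rates[OF n survivor_bounds(1)[OF x], of \<beta> "\<lambda>_. 1"] total_rate_le[OF survivor_bounds(3)[OF x]]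
    by simp
qed (use h finite_E in \<open>auto simp: survivors_def\<close>)

lemma step_eq:
  assumes "x \<in> survivors \<epsilon> n"
  shows "R g x = g x + h * cw_generator \<beta> n (\<lambda>y. of_bool (y \<in> survivors \<epsilon> n) * g y) x"
  using assms
  by (simp add: killed_step_def cw_generator_def sum_cw_rates[OF n survivor_bounds(1)[OF assms],
      where \<phi> = "\<lambda>z. of_bool (z \<in> survivors \<epsilon> n) * g z - g x"])

text \<open>For nonnegative functions killing only removes mass, so upper bounds may use the
  generator without killing.\<close>

lemma step_le_generator:
  assumes x: "x \<in> survivors \<epsilon> n" and "\<And>y. 0 \<le> g y"
  shows "R g x \<le> g x + h * cw_generator \<beta> n g x"
  unfolding step_eq[OF x] cw_generator_def
  using assms rate_plus_nonneg[OF n survivor_bounds(1)[OF x], of \<beta>]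
    rate_minus_nonneg[OF n survivor_bounds(1)[OF x], of \<beta>] h
  by (intro add_left_mono mult_left_mono add_mono) auto

text \<open>The converse comparison: if \<open>g\<close> is nonpositive at the killed states,
  replacing it there by 0 only increases the result. Neighbours outside the grid are reached at rate
  0.\<close>

lemma generator_le_step:
  assumes x: "x \<in> survivors \<epsilon> n" and g: "\<And>y. y \<in> E n \<Longrightarrow> y \<le> \<epsilon> \<Longrightarrow> g y \<le> 0"
  shows "g x + h * cw_generator \<beta> n g x \<le> R g x"
proof -
  have killed: "g y \<le> of_bool (y \<in> survivors \<epsilon> n) * g y" if "y \<in> E n" for y
    using g[OF that] that by (auto simp: survivors_def)
  have "rate_plus \<beta> n x * (g (x + 2 / n) - g x) \<le>
      rate_plus \<beta> n x * (of_bool (x + 2 / n \<in> survivors \<epsilon> n) * g (x + 2 / n) - g x)"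
    using E_right_neighbour[OF n survivor_bounds(1)[OF x], of \<beta>]
  proof
    assume "x + 2 / n \<in> E n"
    then show ?thesis
      by (intro mult_left_mono diff_right_mono killed rate_plus_nonneg[OF n survivor_bounds(1)[OF x]])
  qed simp
  moreover have "rate_minus \<beta> n x * (g (x - 2 / n) - g x) \<le>
      rate_minus \<beta> n x * (of_bool (x - 2 / n \<in> survivors \<epsilon> n) * g (x - 2 / n) - g x)"
    using E_left_neighbour[OF n survivor_bounds(1)[OF x], of \<beta>]
  proof
    assume "x - 2 / n \<in> E n"
    then show ?thesis
      by (intro mult_left_mono diff_right_mono killed rate_minus_nonneg[OF n survivor_bounds(1)[OF x]])
  qed simp
  moreover have alive: "of_bool (x \<in> survivors \<epsilon> n) * g x = g x" using x by simp
  ultimately show ?thesis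
    unfolding step_eq[OF x] cw_generator_def alive
    by (intro add_left_mono mult_left_mono[OF add_mono]) (use h in auto)
qed

text \<open>Jumps have size \<open>2 / n\<close> and total rate of order \<open>n\<close>, so
  besides the drift term only a variance of order \<open>1 / n\<close> remains. This is the source
  of every error in \<open>n\<close>.\<close>

lemma generator_square_le:
  assumes "x \<in> {0..1}"
  shows "cw_generator \<beta> n (\<lambda>y. (y - c)\<^sup>2) x \<le> 2 * (x - c) * cw_drift \<beta> x + 2 * drift_bound \<beta> / n"
proof -
  have "(x + 2 / n - c)\<^sup>2 - (x - c)\<^sup>2 = 4 / n * (x - c) + 4 / n\<^sup>2"
    "(x - 2 / n - c)\<^sup>2 - (x - c)\<^sup>2 = - (4 / n * (x - c)) + 4 / n\<^sup>2"
    using n by (simp_all add: power2_eq_square field_simps)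
  then have eq: "cw_generator \<beta> n (\<lambda>y. (y - c)\<^sup>2) x =
      2 * (x - c) * (2 / n * (rate_plus \<beta> n x - rate_minus \<beta> n x)) +
      4 / n\<^sup>2 * (rate_plus \<beta> n x + rate_minus \<beta> n x)"
    unfolding cw_generator_def by (simp only:) (simp add: algebra_simps add_divide_distrib diff_divide_distrib)
  have drift: "2 / n * (rate_plus \<beta> n x - rate_minus \<beta> n x) = cw_drift \<beta> x"
    using n by (simp add: rate_plus_def rate_minus_def cw_drift_def field_simps)
  have "4 / n\<^sup>2 * (rate_plus \<beta> n x + rate_minus \<beta> n x) \<le> 4 / n\<^sup>2 * (real n * drift_bound \<beta> / 2)"
    by (intro mult_left_mono total_rate_le assms) auto
  also have "\<dots> = 2 * drift_bound \<beta> / n"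
    using n by (simp add: power2_eq_square)
  finally show ?thesis unfolding eq drift by (rule add_left_mono)
qed

lemma square_step_le:
  assumes "x \<in> survivors \<epsilon> n"
  shows "R (\<lambda>y. (y - c)\<^sup>2) x \<le> (x - c)\<^sup>2 + h * (2 * (x - c) * cw_drift \<beta> x + 2 * drift_bound \<beta> / n)"
  by (rule order_trans[OF step_le_generator[OF assms zero_le_power2]])
    (use h in \<open>(intro add_left_mono mult_left_mono generator_square_le survivor_bounds(3)[OF assms]; simp)\<close>)

text \<open>A stationary supersolution: each step contracts the square by
  \<open>1 - 2 * a * h\<close> and adds \<open>h * (2 * drift_bound \<beta> / n)\<close>. Summing
  the geometric series cancels \<open>h\<close> and leaves
  \<open>drift_bound \<beta> / (a * n)\<close>, whatever the starting survivor.\<close>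

lemma relaxation:
  assumes a: "a > 0" "2 * a * h \<le> 1"
    and contr: "\<And>x. x \<in> {\<epsilon>..1} \<Longrightarrow> (x - m_plus \<beta>) * cw_drift \<beta> x \<le> - a * (x - m_plus \<beta>)\<^sup>2"
    and x: "x \<in> survivors \<epsilon> n"
  shows "(R ^^ k) (\<lambda>y. (y - m_plus \<beta>)\<^sup>2) x \<le> exp (- 2 * a * (real k * h)) + drift_bound \<beta> / (a * n)"
proof -
  let ?p = "m_plus \<beta>" and ?r = "1 - 2 * a * h" and ?b = "h * (2 * drift_bound \<beta> / n)"
  have B: "0 \<le> drift_bound \<beta>" by (simp add: drift_bound_def)
  have one: "(x - ?p)\<^sup>2 \<le> 1"
    using survivor_bounds(3)[OF x] m_plus_pos[OF \<beta>] m_plus_less_1[OF \<beta>]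
    by (simp add: abs_square_le_1 abs_le_iff)
  have "(R ^^ k) (\<lambda>y. (y - ?p)\<^sup>2) x \<le> ?r ^ k * (x - ?p)\<^sup>2 + ?b * (\<Sum>i<k. ?r ^ i)"
  proof (rule iterates_le[where w = "\<lambda>_ y. (y - ?p)\<^sup>2"])
    fix y assume y: "y \<in> survivors \<epsilon> n"
    have "h * ((y - ?p) * cw_drift \<beta> y) \<le> h * (- a * (y - ?p)\<^sup>2)"
      using contr[OF survivor_bounds(2)[OF y]] h by (intro mult_left_mono) auto
    then show "R (\<lambda>y. (y - ?p)\<^sup>2) y \<le> ?r * (y - ?p)\<^sup>2 + ?b"
      using square_step_le[OF y, of ?p] by (simp add: algebra_simps)
  qed (use a h B x in auto)
  also have "\<dots> \<le> exp (- 2 * a * (real k * h)) * 1 + ?b * (1 / (2 * a * h))"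
  proof (intro add_mono mult_mono mult_left_mono)
    have "?r ^ k \<le> exp (- 2 * a * h) ^ k"
      using a exp_ge_add_one_self[of "- 2 * a * h"] by (intro power_mono) auto
    then show "?r ^ k \<le> exp (- 2 * a * (real k * h))"
      by (simp flip: exp_of_nat_mult add: mult_ac)
    have "(\<Sum>i<k. ?r ^ i) = (1 - ?r ^ k) / (2 * a * h)"
      using sum_gp_strict[of ?r k] a h by simp
    also have "\<dots> \<le> 1 / (2 * a * h)"
      using a h by (intro divide_right_mono) auto
    finally show "(\<Sum>i<k. ?r ^ i) \<le> 1 / (2 * a * h)" .
  qed (use one a h B in \<open>auto intro!: sum_nonneg\<close>)
  also have "\<dots> = exp (- 2 * a * (real k * h)) + drift_bound \<beta> / (a * n)"
    using h a by (simp add: field_simps)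
  finally show ?thesis .
qed

lemma tracking:
  assumes \<mu>: "cw_flow \<beta> m\<^sub>0 \<mu>" "\<And>t. 0 \<le> t \<Longrightarrow> \<mu> t \<in> {0..1}" and m\<^sub>0: "m\<^sub>0 \<in> survivors \<epsilon> n"
  shows "(R ^^ N) (\<lambda>y. (y - \<mu> (real N * h))\<^sup>2) m\<^sub>0 \<le>
    (drift_bound \<beta> / (drift_lip \<beta> * n) + 3 * drift_bound \<beta> * h) * exp (2 * drift_lip \<beta> * (real N * h))"
proof -
  define K where "K = drift_lip \<beta>"
  define B where "B = drift_bound \<beta>"
  \<comment> \<open>In the term of order \<open>h\<^sup>2\<close>, the coefficient 6 consists of 2
    from the Euler error of the flow and 4 from recentring the square at \<open>\<mu> s\<close>
    instead of \<open>\<mu> (s + h)\<close>.\<close>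
  let ?r = "1 + 2 * K * h" and ?b = "h * (2 * B / n + 6 * K * B * h)"
  have KB: "0 < K" "0 \<le> B" using \<beta> by (auto simp: K_def B_def drift_lip_def drift_bound_def intro!: add_pos_pos)
  \<comment> \<open>The centre runs back along the flow and after \<open>N\<close> steps is
    \<open>\<mu> 0\<close>, the starting point itself, so no initial term survives.\<close>
  let ?w = "\<lambda>i y. (y - \<mu> (real (N - i) * h))\<^sup>2"
  have "(R ^^ N) (?w 0) m\<^sub>0 \<le> ?r ^ N * ?w N m\<^sub>0 + ?b * (\<Sum>i<N. ?r ^ i)"
  proof (rule iterates_le)
    fix i x assume i: "i < N" and x: "x \<in> survivors \<epsilon> n"
    define s where "s = real (N - Suc i) * h"
    have "real (N - i) = real (N - Suc i) + 1" using i by simp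
    then have s: "0 \<le> s" "real (N - i) * h = s + h"
      using h by (simp_all only: s_def distrib_right) simp_all
    define y where "y = \<mu> s"
    define y' where "y' = \<mu> (s + h)"
    have y: "y \<in> {0..1}" "y' \<in> {0..1}" using \<mu>(2) s h by (auto simp: y_def y'_def)
    have x01: "x \<in> {0..1}" using survivor_bounds(3)[OF x] .
    define e where "e = y' - y - h * cw_drift \<beta> y'"
    have e: "\<bar>e\<bar> \<le> K * B * h\<^sup>2"
      using cw_flow_step(1)[OF _ \<mu> s(1), of h] h \<beta> by (simp add: e_def y_def y'_def K_def B_def)
    have yy: "\<bar>y' - y\<bar> \<le> B * h"
      using cw_flow_step(2)[OF _ \<mu> s(1), of h] h \<beta> by (simp add: y_def y'_def B_def)
    have "(x - y)\<^sup>2 = (x - y')\<^sup>2 + 2 * h * ((x - y') * cw_drift \<beta> y') + 2 * ((x - y') * e) + (y' - y)\<^sup>2"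
      by (simp add: e_def power2_eq_square algebra_simps)
    moreover have "\<bar>x - y'\<bar> * \<bar>e\<bar> \<le> 1 * (K * B * h\<^sup>2)"
      using e x01 y by (intro mult_mono) auto
    then have "- (K * B * h\<^sup>2) \<le> (x - y') * e"
      by (simp flip: abs_mult add: abs_le_iff)
    ultimately have 1: "(x - y')\<^sup>2 \<le> (x - y)\<^sup>2 - 2 * h * ((x - y') * cw_drift \<beta> y') + 2 * (K * B * h\<^sup>2)"
      using zero_le_power2[of "y' - y"] by linarith
    have "(x - y')\<^sup>2 - (x - y)\<^sup>2 = (y' - y) * (y' + y - 2 * x)"
      by (simp add: power2_eq_square algebra_simps)
    also have "\<dots> \<le> \<bar>y' - y\<bar> * \<bar>y' + y - 2 * x\<bar>" by (simp flip: abs_mult)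
    also have "\<dots> \<le> (B * h) * 2"
      using yy y x01 KB h by (intro mult_mono) auto
    finally have 2: "(x - y')\<^sup>2 \<le> (x - y)\<^sup>2 + 2 * (B * h)" by simp
    have "(x - y') * (cw_drift \<beta> x - cw_drift \<beta> y') \<le> \<bar>x - y'\<bar> * \<bar>cw_drift \<beta> x - cw_drift \<beta> y'\<bar>"
      by (simp flip: abs_mult)
    also have "\<dots> \<le> \<bar>x - y'\<bar> * (K * \<bar>x - y'\<bar>)"
      unfolding K_def using x01 y \<beta> by (intro mult_left_mono cw_drift_lipschitz) auto
    also have "\<dots> = K * (x - y')\<^sup>2" by (simp add: power2_eq_square)
    also have "\<dots> \<le> K * ((x - y)\<^sup>2 + 2 * (B * h))" using 2 KB by (intro mult_left_mono) auto
    finally have 3: "2 * h * ((x - y') * (cw_drift \<beta> x - cw_drift \<beta> y')) \<le> 2 * h * (K * ((x - y)\<^sup>2 + 2 * (B * h)))"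
      using h by (intro mult_left_mono) auto
    have "R (\<lambda>z. (z - y')\<^sup>2) x \<le> (x - y')\<^sup>2 + h * (2 * (x - y') * cw_drift \<beta> x + 2 * B / n)"
      using square_step_le[OF x] by (simp add: B_def)
    also have "\<dots> \<le> (x - y)\<^sup>2 + 2 * h * ((x - y') * (cw_drift \<beta> x - cw_drift \<beta> y')) + 2 * (K * B * h\<^sup>2) + h * (2 * B / n)"
      using 1 by (simp add: algebra_simps)
    also have "\<dots> \<le> ?r * (x - y)\<^sup>2 + ?b"
      using 3 by (simp add: algebra_simps power2_eq_square)
    finally show "R (?w i) x \<le> ?r * ?w (Suc i) x + ?b"
      by (simp add: s(2) y_def y'_def s_def)
  qed (use KB h m\<^sub>0 in auto)
  also have "?w N m\<^sub>0 = 0" using \<mu>(1) by (simp add: cw_flow_def)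
  also have "(\<Sum>i<N. ?r ^ i) = (?r ^ N - 1) / (2 * K * h)"
    using KB h sum_gp_strict[of ?r N] by (simp add: field_simps)
  also have "?b * ((?r ^ N - 1) / (2 * K * h)) = (B / (K * n) + 3 * B * h) * (?r ^ N - 1)"
    using KB h n by (simp add: field_simps)
  also have "\<dots> \<le> (B / (K * n) + 3 * B * h) * exp (2 * K * (real N * h))"
  proof (intro mult_left_mono)
    have "?r ^ N \<le> exp (2 * K * h) ^ N"
      using KB h exp_ge_add_one_self[of "2 * K * h"] by (intro power_mono) auto
    then show "?r ^ N - 1 \<le> exp (2 * K * (real N * h))"
      by (simp flip: exp_of_nat_mult add: mult_ac)
  qed (use KB h in auto)
  finally show ?thesis by (simp add: K_def B_def)
qed

section \<open>Lower bounds on survival\<close>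

lemma survival_crude:
  assumes "x \<in> survivors \<epsilon> n"
  shows "(1 - h * (real n * drift_bound \<beta>)) ^ k \<le> (R ^^ k) (\<lambda>_. 1) x"
proof -
  let ?\<Lambda> = "real n * drift_bound \<beta>"
  \<comment> \<open>The comparison principle yields upper bounds, hence the constant function
    -1.\<close>
  have "(R ^^ k) (\<lambda>_. - 1) x \<le> (1 - h * ?\<Lambda>) ^ k * (- 1) + 0 * (\<Sum>i<k. (1 - h * ?\<Lambda>) ^ i)"
  proof (rule iterates_le[where w = "\<lambda>_ _. - 1"])
    fix y assume y: "y \<in> survivors \<epsilon> n"
    have "- (\<Sum>z\<in>E n. cw_rates \<beta> n y z) \<le> (\<Sum>z\<in>E n. cw_rates \<beta> n y z * (of_bool (z \<in> survivors \<epsilon> n) - 1))"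
      unfolding sum_negf[symmetric] using q_nonneg[OF y] by (intro sum_mono) auto
    then have "- ?\<Lambda> \<le> (\<Sum>z\<in>E n. cw_rates \<beta> n y z * (of_bool (z \<in> survivors \<epsilon> n) - 1))"
      using q_sum[OF y] by linarith
    then have "h * (- ?\<Lambda>) \<le> h * (\<Sum>z\<in>E n. cw_rates \<beta> n y z * (of_bool (z \<in> survivors \<epsilon> n) - 1))"
      using h by (intro mult_left_mono) auto
    then have "1 - h * ?\<Lambda> \<le> R (\<lambda>_. 1) y" by (simp add: killed_step_def)
    then show "R (\<lambda>_. - 1) y \<le> (1 - h * ?\<Lambda>) * - 1 + 0"
      using killed_iterates_uminus[of 1 "E n" "survivors \<epsilon> n" "cw_rates \<beta> n" h "\<lambda>_. 1"] by simp
  qed (use h assms in auto)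
  then show ?thesis by (simp add: killed_iterates_uminus[where g = "\<lambda>_. 1"])
qed

text \<open>Gambler's ruin: \<open>1 / \<theta>\<close> bounds the ruin probability of the lowest
  survivor for a walk whose upward rate is at least \<theta> times the downward one. That ratio is
  assumed up to \<eta> only; above \<eta> the comparison function is exponentially small, and the
  loss there is paid for by a term linear in time.\<close>

lemma survival:
  assumes \<theta>: "\<theta> > 1" and ratio: "\<And>x. x \<in> {\<epsilon>..\<eta>} \<Longrightarrow> \<theta> * rate_minus \<beta> n x \<le> rate_plus \<beta> n x"
    and x: "x \<in> survivors \<epsilon> n"
  shows "1 - 1 / \<theta> - real k * h * ((\<theta> - 1) * n * \<theta> powr (- (real n * (\<eta> - \<epsilon>) / 2))) \<le> (R ^^ k) (\<lambda>_. 1) x"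
proof -
  define j where "j = \<lfloor>real n * (1 + \<epsilon>) / 2\<rfloor>"
  \<comment> \<open>the state at which the chain is killed: aligning \<open>v\<close> with it rather than with \<open>\<epsilon>\<close> keeps
    \<open>1 - v\<close> bounded from below on the survivors next to \<open>\<epsilon>\<close>\<close>
  define l where "l = - 1 + 2 * of_int j / real n"
  define v where "v y = \<theta> powr (- (real n * (y - l) / 2))" for y
  \<comment> \<open>The largest rate at which \<open>1 - v\<close> can decrease above \<eta>: the
    downward rate is at most \<open>n\<close>, and \<open>v\<close> is at most its value at distance
    \<eta> - \<epsilon> from \<open>l\<close>.\<close>
  define \<kappa> where "\<kappa> = (\<theta> - 1) * n * \<theta> powr (- (real n * (\<eta> - \<epsilon>) / 2))"
  have l: "l \<le> \<epsilon>"
  proof -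
    have "of_int j \<le> real n * (1 + \<epsilon>) / 2" unfolding j_def by (rule of_int_floor_le)
    then show ?thesis using n by (simp add: l_def field_simps)
  qed
  have E_index: "\<exists>i. y = - 1 + 2 * real i / real n" if "y \<in> E n" for y
    using that by (auto simp: E_def)
  have v_killed: "1 \<le> v y" if y: "y \<in> E n" "y \<le> \<epsilon>" for y
  proof -
    obtain i where i: "y = - 1 + 2 * real i / real n" using E_index[OF y(1)] by blast
    then have "real_of_int (int i) = real n * (1 + y) / 2" using n by (simp add: field_simps)
    also have "\<dots> \<le> real n * (1 + \<epsilon>) / 2"
      using y(2) by (intro divide_right_mono mult_left_mono) auto
    finally have "int i \<le> j" unfolding j_def le_floor_iff .
    then have "y \<le> l" using n unfolding i l_def by (simp add: divide_right_mono)
    then show ?thesis using \<theta> unfolding v_def by (intro ge_one_powr_ge_zero) (auto simp: mult_nonneg_nonpos)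
  qed
  have v_alive: "v y \<le> 1 / \<theta>" if y: "y \<in> survivors \<epsilon> n" for y
  proof -
    obtain i where i: "y = - 1 + 2 * real i / real n" using E_index[OF survivor_bounds(1)[OF y]] by blast
    have "real n * (1 + \<epsilon>) / 2 < real n * (1 + y) / 2"
      using n y by (intro divide_strict_right_mono mult_strict_left_mono) (auto simp: survivors_def)
    also have "\<dots> = real_of_int (int i)" using n i by (simp add: field_simps)
    finally have "j < int i" unfolding j_def floor_less_iff .
    then have "real_of_int (j + 1) \<le> real_of_int (int i)" by linarith
    moreover have "real n * (y - l) / 2 = real i - real_of_int j"
      using n unfolding i l_def by (simp add: field_simps)
    ultimately have "real n * (y - l) / 2 \<ge> 1" by simp
    then have "v y \<le> \<theta> powr (- 1)" using \<theta> unfolding v_def by (intro powr_mono) auto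
    then show ?thesis using \<theta> by (simp add: powr_minus_divide)
  qed
  have v_shift: "v (y + 2 / n) = v y / \<theta>" "v (y - 2 / n) = v y * \<theta>" for y
  proof -
    have "- (real n * (y + 2 / n - l) / 2) = - (real n * (y - l) / 2) - 1"
      "- (real n * (y - 2 / n - l) / 2) = - (real n * (y - l) / 2) + 1"
      using n by (simp_all add: field_simps)
    then show "v (y + 2 / n) = v y / \<theta>" "v (y - 2 / n) = v y * \<theta>"
      unfolding v_def using \<theta> by (simp_all only: powr_diff powr_add) simp_all
  qed
  \<comment> \<open>A jump multiplies or divides \<open>v\<close> by \<theta>, so the generator
    factorises and its sign is that of the rate comparison.\<close>
  have gen: "cw_generator \<beta> n (\<lambda>y. 1 - v y) y = v y * (1 - 1 / \<theta>) * (rate_plus \<beta> n y - \<theta> * rate_minus \<beta> n y)" for y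
    using \<theta> by (simp add: cw_generator_def v_shift field_simps)
  have v_pos: "0 < v y" for y using \<theta> by (simp add: v_def)
  have gen_ge: "- \<kappa> \<le> cw_generator \<beta> n (\<lambda>y. 1 - v y) y" if y: "y \<in> survivors \<epsilon> n" for y
  proof (cases "y \<le> \<eta>")
    case True
    then have "0 \<le> rate_plus \<beta> n y - \<theta> * rate_minus \<beta> n y"
      using ratio[of y] survivor_bounds(2)[OF y] by simp
    then have "0 \<le> cw_generator \<beta> n (\<lambda>y. 1 - v y) y"
      unfolding gen using \<theta> v_pos[of y] by (intro mult_nonneg_nonneg) auto
    moreover have "0 \<le> \<kappa>" using \<theta> by (simp add: \<kappa>_def)
    ultimately show ?thesis by linarith
  next
    case False
    then have "real n * (\<eta> - \<epsilon>) / 2 \<le> real n * (y - l) / 2"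
      using l by (intro divide_right_mono mult_left_mono) auto
    then have v_le: "v y \<le> \<theta> powr (- (real n * (\<eta> - \<epsilon>) / 2))"
      unfolding v_def using \<theta> by (intro powr_mono) auto
    have "- \<kappa> = - (\<theta> powr (- (real n * (\<eta> - \<epsilon>) / 2)) * ((\<theta> - 1) * n))" by (simp add: \<kappa>_def)
    also have "\<dots> \<le> - (v y * ((\<theta> - 1) * rate_minus \<beta> n y))"
      using v_le v_pos[of y] \<theta> rate_minus_le[OF survivor_bounds(3)[OF y]]
        rate_minus_nonneg[OF n survivor_bounds(1)[OF y], of \<beta>]
      by (intro le_imp_neg_le mult_mono) auto
    also have "\<dots> = v y * (1 - 1 / \<theta>) * (0 - \<theta> * rate_minus \<beta> n y)"
      using \<theta> by (simp add: field_simps)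
    also have "\<dots> \<le> v y * (1 - 1 / \<theta>) * (rate_plus \<beta> n y - \<theta> * rate_minus \<beta> n y)"
      using \<theta> v_pos[of y] rate_plus_nonneg[OF n survivor_bounds(1)[OF y], of \<beta>]
      by (intro mult_left_mono diff_right_mono) auto
    finally show ?thesis by (simp only: gen)
  qed
  have "(R ^^ k) (\<lambda>y. - (1 - v y)) x \<le> 1 ^ k * - (1 - v x) + h * \<kappa> * (\<Sum>i<k. 1 ^ i)"
  proof (rule iterates_le[where w = "\<lambda>_ y. - (1 - v y)"])
    fix y assume y: "y \<in> survivors \<epsilon> n"
    have "1 - v y + h * - \<kappa> \<le> 1 - v y + h * cw_generator \<beta> n (\<lambda>y. 1 - v y) y"
      using gen_ge[OF y] h by (intro add_left_mono mult_left_mono) auto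
    also have "\<dots> \<le> R (\<lambda>y. 1 - v y) y"
      using v_killed by (intro generator_le_step[OF y]) simp
    finally show "R (\<lambda>y. - (1 - v y)) y \<le> 1 * - (1 - v y) + h * \<kappa>"
      using killed_iterates_uminus[of 1 "E n" "survivors \<epsilon> n" "cw_rates \<beta> n" h "\<lambda>y. 1 - v y"] by simp
  qed (use h \<theta> x in \<open>auto simp: \<kappa>_def\<close>)
  then have "1 - v x - real k * h * \<kappa> \<le> (R ^^ k) (\<lambda>y. 1 - v y) x"
    by (simp only: killed_iterates_uminus) (simp add: algebra_simps)
  also have "\<dots> \<le> (R ^^ k) (\<lambda>_. 1) x"
    using v_pos by (intro iterates_mono[OF _ x]) (simp add: less_imp_le)
  finally show ?thesis using v_alive[OF x] by (simp add: \<kappa>_def)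
qed

end

section \<open>The chain conditioned to survive\<close>

lemma E_subset_Rats: "E n \<subseteq> \<rat>"
  by (auto simp: E_def)

text \<open>Young's inequality with free parameter \<open>s\<close>. The trailing factor 1 lets the
  linearity lemmas match the constant as a multiple of the function 1, whose killed mean is the
  survival probability.\<close>

lemma abs_le_square_mean:
  fixes y c s :: real
  assumes "s > 0"
  shows "\<bar>y - c\<bar> \<le> (1 / (2 * s)) * (y - c)\<^sup>2 + (s / 2) * 1"
proof -
  have "0 \<le> (\<bar>y - c\<bar> - s)\<^sup>2" by simp
  then have "2 * s * \<bar>y - c\<bar> \<le> (y - c)\<^sup>2 + s\<^sup>2"
    by (simp add: power2_diff algebra_simps)
  then show ?thesis using assms by (simp add: field_simps power2_eq_square)
qed

locale cw_conditioned = jump_chain M X "E n" "cw_rates \<beta> n" m\<^sub>0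
  for M :: "'a measure" and X :: "real \<Rightarrow> 'a \<Rightarrow> real" and \<beta> :: real and n :: nat and m\<^sub>0 :: real +
  fixes \<epsilon> t :: real and \<mu> :: "real \<Rightarrow> real"
  assumes \<beta>: "\<beta> > 1" and \<epsilon>: "0 < \<epsilon>" "\<epsilon> < m_plus \<beta>" "\<epsilon> \<notin> \<rat>" and n: "n \<ge> 1"
    and m\<^sub>0: "m\<^sub>0 \<in> survivors \<epsilon> n" and t: "0 \<le> t" and flow: "cw_flow \<beta> m\<^sub>0 \<mu>"
begin

definition survives :: "'a set" where
  "survives = {\<omega> \<in> space M. ereal t < hitting_time_below X \<epsilon> \<omega>}"

definition killed_mean :: "(real \<Rightarrow> real) \<Rightarrow> real" where
  "killed_mean g = (LINT \<omega>|M. g (X t \<omega>) * indicator survives \<omega>)"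

lemma rates_nonneg: "x \<in> E n \<Longrightarrow> 0 \<le> cw_rates \<beta> n x y"
  using rate_plus_nonneg[OF n] rate_minus_nonneg[OF n] by (simp add: cw_rates_def)

lemma m\<^sub>0_bounds: "m\<^sub>0 \<in> E n" "\<epsilon> < m\<^sub>0" "m\<^sub>0 \<in> {\<epsilon>..1}"
  using m\<^sub>0 E_bounds[OF n, of m\<^sub>0] by (auto simp: survivors_def)

lemma
  shows survives_events: "survives \<in> events"
    and step_limit: "(\<lambda>N. (killed_step (E n) (survivors \<epsilon> n) (cw_rates \<beta> n) (t / real N) ^^ N) g m\<^sub>0)
      \<longlonglongrightarrow> killed_mean g"
proof -
  have "\<epsilon> \<notin> E n" using \<epsilon> E_subset_Rats by auto
  from killed_expectation_limit[OF rates_nonneg t this m\<^sub>0_bounds(2,1)]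
  show "survives \<in> events" "(\<lambda>N. (killed_step (E n) (survivors \<epsilon> n) (cw_rates \<beta> n) (t / real N) ^^ N) g m\<^sub>0)
      \<longlonglongrightarrow> killed_mean g"
    unfolding survives_def killed_mean_def survivors_def by blast+
qed

lemma integrable_survivors: "integrable M (\<lambda>\<omega>. g (X t \<omega>) * indicator survives \<omega>)" for g :: "real \<Rightarrow> real"
  by (rule integrable_real_mult_indicator[OF survives_events integrable_state_function[OF t]])

lemma X_survives: "\<omega> \<in> survives \<Longrightarrow> X t \<omega> \<in> survivors \<epsilon> n"
  using in_states t less_hitting_time_iff[of \<omega> t \<epsilon>] by (auto simp: survives_def survivors_def)

lemma survivor_range: "z \<in> survivors \<epsilon> n \<Longrightarrow> z \<in> {0..1}"
  using E_bounds[OF n, of z] \<epsilon> by (auto simp: survivors_def)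

lemma killed_mean_mono:
  assumes "\<And>z. z \<in> survivors \<epsilon> n \<Longrightarrow> g z \<le> g' z"
  shows "killed_mean g \<le> killed_mean g'"
  unfolding killed_mean_def using assms X_survives
  by (intro integral_mono integrable_survivors) (auto split: split_indicator)

lemma killed_mean_linear: "killed_mean (\<lambda>z. a * g z + b * g' z) = a * killed_mean g + b * killed_mean g'"
proof -
  have "killed_mean (\<lambda>z. a * g z + b * g' z) = (LINT \<omega>|M. a * (g (X t \<omega>) * indicator survives \<omega>) + b * (g' (X t \<omega>) * indicator survives \<omega>))"
    unfolding killed_mean_def by (simp add: algebra_simps)
  also have "\<dots> = a * killed_mean g + b * killed_mean g'"
    unfolding killed_mean_def using integrable_survivors
    by (subst Bochner_Integration.integral_add) auto
  finally show ?thesis .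
qed

lemma killed_mean_one: "killed_mean (\<lambda>_. 1) = prob survives"
  unfolding killed_mean_def using survives_events sets.sets_into_space[OF survives_events] by (simp add: Int_absorb2)

lemma killed_mean_const: "killed_mean (\<lambda>_. c) = c * prob survives"
  using killed_mean_linear[of c "\<lambda>_. 1" 0 "\<lambda>_. 1"] by (simp add: killed_mean_one)

lemma killed_mean_le_limit:
  assumes "\<forall>\<^sub>F N in sequentially.
      (killed_step (E n) (survivors \<epsilon> n) (cw_rates \<beta> n) (t / real N) ^^ N) g m\<^sub>0 \<le> c N"
    and "c \<longlonglongrightarrow> c'"
  shows "killed_mean g \<le> c'"
  using tendsto_le[OF _ assms(2) step_limit assms(1)] by simp

lemma killed_mean_ge_limit:
  assumes "\<forall>\<^sub>F N in sequentially.
      c N \<le> (killed_step (E n) (survivors \<epsilon> n) (cw_rates \<beta> n) (t / real N) ^^ N) g m\<^sub>0"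
    and "c \<longlonglongrightarrow> c'"
  shows "c' \<le> killed_mean g"
  using tendsto_le[OF _ step_limit assms(2) assms(1)] by simp

lemma eventually_small_step:
  assumes "0 < t" "0 < d"
  shows "\<forall>\<^sub>F N in sequentially. cw_killed \<beta> \<epsilon> n (t / real N) \<and> t / real N < d \<and> 0 < N"
proof -
  have "\<forall>\<^sub>F N in sequentially. t / real N * (real n * drift_bound \<beta>) < 1"
    by (rule order_tendstoD) (real_asymp, simp)
  moreover have "\<forall>\<^sub>F N in sequentially. t / real N < d"
    by (rule order_tendstoD[OF _ assms(2)]) real_asymp
  ultimately show ?thesis
    using eventually_gt_at_top[of 0]
    by eventually_elim (use \<beta> \<epsilon> n assms in \<open>auto simp: cw_killed_def\<close>)
qed

lemma flow_range: "0 \<le> s \<Longrightarrow> \<mu> s \<in> {\<epsilon>..1}"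
  using cw_flow_bounds[OF \<beta> \<epsilon>(1,2) flow m\<^sub>0_bounds(3)] .

lemma flow_range01: "0 \<le> s \<Longrightarrow> \<mu> s \<in> {0..1}"
  using flow_range[of s] \<epsilon>(1) by auto

text \<open>Only positivity is wanted, to allow the division. The bound degenerates in
  \<open>n\<close> and \<open>t\<close>; quantitative lower bounds come from
  \<open>survival\<close>.\<close>

lemma prob_survives_pos:
  assumes "0 < t"
  shows "0 < prob survives"
proof -
  let ?\<Lambda> = "real n * drift_bound \<beta>"
  have "exp (- ?\<Lambda> * t) \<le> killed_mean (\<lambda>_. 1)"
  proof (rule killed_mean_ge_limit)
    show "\<forall>\<^sub>F N in sequentially. (1 + (- ?\<Lambda> * t) / real N) ^ N \<le>
        (killed_step (E n) (survivors \<epsilon> n) (cw_rates \<beta> n) (t / real N) ^^ N) (\<lambda>_. 1) m\<^sub>0"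
      using eventually_small_step[OF assms zero_less_one]
    proof eventually_elim
      case (elim N)
      then interpret cw_killed \<beta> \<epsilon> n "t / real N" by simp
      show ?case using survival_crude[OF m\<^sub>0, of N] by (simp add: algebra_simps)
    qed
    show "(\<lambda>N. (1 + (- ?\<Lambda> * t) / real N) ^ N) \<longlonglongrightarrow> exp (- ?\<Lambda> * t)"
      by (rule tendsto_exp_limit_sequentially)
  qed
  then show ?thesis
    using exp_gt_zero[of "- ?\<Lambda> * t"] unfolding killed_mean_one by linarith
qed

lemma killed_mean_abs_le:
  assumes "s > 0"
  shows "killed_mean (\<lambda>z. \<bar>z - c\<bar>) \<le> (killed_mean (\<lambda>z. (z - c)\<^sup>2) / s + s * prob survives) / 2"
proof -
  have "killed_mean (\<lambda>z. \<bar>z - c\<bar>) \<le> killed_mean (\<lambda>z. (1 / (2 * s)) * (z - c)\<^sup>2 + (s / 2) * 1)"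
    by (intro killed_mean_mono abs_le_square_mean assms)
  also have "\<dots> = (1 / (2 * s)) * killed_mean (\<lambda>z. (z - c)\<^sup>2) + (s / 2) * prob survives"
    by (subst killed_mean_linear) (simp add: killed_mean_one)
  finally show ?thesis by (simp add: field_simps)
qed

text \<open>As long as \<open>exp (2 K t)\<close> is small compared to \<open>n\<close>, Gronwall's inequality keeps the chain
  close to the flow.\<close>

lemma short_time:
  assumes "0 < t" and \<theta>: "\<theta> > 1"
    and ratio: "\<And>x. x \<in> {\<epsilon>..\<eta>} \<Longrightarrow> \<theta> * rate_minus \<beta> n x \<le> rate_plus \<beta> n x"
  shows "killed_mean (\<lambda>z. (z - \<mu> t)\<^sup>2) \<le> drift_bound \<beta> / (drift_lip \<beta> * n) * exp (2 * drift_lip \<beta> * t)"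
    and "1 - 1 / \<theta> - t * ((\<theta> - 1) * n * \<theta> powr (- (real n * (\<eta> - \<epsilon>) / 2))) \<le> prob survives"
proof -
  let ?B = "drift_bound \<beta>" and ?K = "drift_lip \<beta>"
  show "killed_mean (\<lambda>z. (z - \<mu> t)\<^sup>2) \<le> ?B / (?K * n) * exp (2 * ?K * t)"
  proof (rule killed_mean_le_limit)
    show "\<forall>\<^sub>F N in sequentially.
        (killed_step (E n) (survivors \<epsilon> n) (cw_rates \<beta> n) (t / real N) ^^ N) (\<lambda>z. (z - \<mu> t)\<^sup>2) m\<^sub>0
        \<le> (?B / (?K * n) + 3 * ?B * (t / real N)) * exp (2 * ?K * t)"
      using eventually_small_step[OF assms(1) zero_less_one]
    proof eventually_elim
      case (elim N)
      then interpret cw_killed \<beta> \<epsilon> n "t / real N" by simp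
      show ?case using tracking[OF flow flow_range01 m\<^sub>0, of N] elim by simp
    qed
    show "(\<lambda>N. (?B / (?K * n) + 3 * ?B * (t / real N)) * exp (2 * ?K * t))
        \<longlonglongrightarrow> ?B / (?K * n) * exp (2 * ?K * t)"
      by real_asymp
  qed
  let ?\<kappa> = "(\<theta> - 1) * n * \<theta> powr (- (real n * (\<eta> - \<epsilon>) / 2))"
  show "1 - 1 / \<theta> - t * ?\<kappa> \<le> prob survives"
    unfolding killed_mean_one[symmetric]
  proof (rule killed_mean_ge_limit[OF _ tendsto_const])
    show "\<forall>\<^sub>F N in sequentially. 1 - 1 / \<theta> - t * ?\<kappa> \<le>
        (killed_step (E n) (survivors \<epsilon> n) (cw_rates \<beta> n) (t / real N) ^^ N) (\<lambda>_. 1) m\<^sub>0"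
      using eventually_small_step[OF assms(1) zero_less_one]
    proof eventually_elim
      case (elim N)
      then interpret cw_killed \<beta> \<epsilon> n "t / real N" by simp
      show ?case using survival[where \<eta> = \<eta> and k = N, OF \<theta> ratio m\<^sub>0] elim by simp
    qed
  qed
qed

text \<open>The bound is obtained by restarting the chain at time \<open>t - T\<close> from an arbitrary survivor: it
  then survives up to time \<open>t\<close> with a probability bounded from below, while the
  second moment of the distance to \<open>m\<^sub>+\<close> has become small whatever the starting point.\<close>

lemma long_time:
  assumes T: "0 \<le> T" "T < t" and \<theta>: "\<theta> > 1"
    and ratio: "\<And>x. x \<in> {\<epsilon>..\<eta>} \<Longrightarrow> \<theta> * rate_minus \<beta> n x \<le> rate_plus \<beta> n x"
    and a: "a > 0"
    and contr: "\<And>x. x \<in> {\<epsilon>..1} \<Longrightarrow> (x - m_plus \<beta>) * cw_drift \<beta> x \<le> - a * (x - m_plus \<beta>)\<^sup>2"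
    and c: "c > 0" "c \<le> 1 - 1 / \<theta> - (T + 1) * ((\<theta> - 1) * n * \<theta> powr (- (real n * (\<eta> - \<epsilon>) / 2)))"
    and s: "s > 0"
  shows "killed_mean (\<lambda>z. \<bar>z - m_plus \<beta>\<bar>) \<le>
    ((exp (- 2 * a * T) + drift_bound \<beta> / (a * n)) / (s * c) + s) / 2 * prob survives"
proof -
  let ?p = "m_plus \<beta>"
  let ?\<kappa> = "(\<theta> - 1) * n * \<theta> powr (- (real n * (\<eta> - \<epsilon>) / 2))"
  define W where "W = exp (- 2 * a * T) + drift_bound \<beta> / (a * n)"
  define \<delta> where "\<delta> = (W / (s * c) + s) / 2"
  have W: "0 \<le> W" using a by (simp add: W_def drift_bound_def)
  have "0 < t" using T by simp
  have "0 < min 1 (1 / (2 * a))" using a by simp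
  \<comment> \<open>Moving \<delta> under the mean turns the claim into a sign condition, which
    monotone steps preserve for as long as one likes.\<close>
  have "killed_mean (\<lambda>z. 1 * \<bar>z - ?p\<bar> + (- \<delta>) * 1) \<le> 0"
  proof (rule killed_mean_le_limit[OF _ tendsto_const])
    show "\<forall>\<^sub>F N in sequentially.
        (killed_step (E n) (survivors \<epsilon> n) (cw_rates \<beta> n) (t / real N) ^^ N) (\<lambda>z. 1 * \<bar>z - ?p\<bar> + (- \<delta>) * 1) m\<^sub>0 \<le> 0"
      using eventually_small_step[OF \<open>0 < t\<close> \<open>0 < min 1 (1 / (2 * a))\<close>]
    proof eventually_elim
      case (elim N)
      define h where "h = t / real N"
      interpret cw_killed \<beta> \<epsilon> n h using elim by (simp add: h_def)
      have h: "0 < h" "h < 1" "2 * a * h \<le> 1" "real N * h = t"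
        using elim \<open>0 < t\<close> a by (auto simp: h_def field_simps)
      \<comment> \<open>The steps covering the last \<open>T\<close> time units. Rounding up keeps
        the relaxation time at least \<open>T\<close> and overshoots by less than one step, hence
        the \<open>T + 1\<close> in the survival hypothesis.\<close>
      define k where "k = nat \<lceil>T / h\<rceil>"
      have "0 \<le> T / h" using T h by simp
      then have "real k = of_int \<lceil>T / h\<rceil>" by (simp add: k_def)
      then have "T / h \<le> real k" "real k < T / h + 1" by linarith+
      then have kh: "T \<le> real k * h" "real k * h < T + h"
        using h by (simp_all add: field_simps)
      have "T / h < real N" using T h by (simp add: pos_divide_less_eq)
      then have "k \<le> N" using \<open>real k < T / h + 1\<close> by linarith
      have surv: "c \<le> (R ^^ k) (\<lambda>_. 1) x" if "x \<in> survivors \<epsilon> n" for x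
      proof -
        have "real k * h * ?\<kappa> \<le> (T + 1) * ?\<kappa>"
          using kh h \<theta> by (intro mult_right_mono) auto
        then show ?thesis using survival[where \<eta> = \<eta> and k = k, OF \<theta> ratio that] c by linarith
      qed
      have dev: "(R ^^ k) (\<lambda>z. 1 * \<bar>z - ?p\<bar> + (- \<delta>) * 1) x \<le> 0" if x: "x \<in> survivors \<epsilon> n" for x
      proof -
        let ?S = "(R ^^ k) (\<lambda>_. 1) x" and ?Q = "(R ^^ k) (\<lambda>z. (z - ?p)\<^sup>2) x"
        have "?Q \<le> exp (- 2 * a * (real k * h)) + drift_bound \<beta> / (a * n)"
          using relaxation[OF a h(3) contr x] .
        also have "\<dots> \<le> W" using kh(1) a by (simp add: W_def)
        \<comment> \<open>Survival over the last steps is at least \<open>c\<close>, so inserting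
          \<open>?S / c\<close> makes the second moment proportional to it as well.\<close>
        also have "\<dots> \<le> W * (?S / c)"
          using mult_left_mono[of 1 "?S / c" W] surv[OF x] c(1) W by simp
        finally have Q: "?Q \<le> W * (?S / c)" .
        have "(R ^^ k) (\<lambda>z. \<bar>z - ?p\<bar>) x \<le> (R ^^ k) (\<lambda>z. (1 / (2 * s)) * (z - ?p)\<^sup>2 + (s / 2) * 1) x"
          by (intro iterates_mono x abs_le_square_mean s)
        also have "\<dots> = (1 / (2 * s)) * ?Q + (s / 2) * ?S"
          by (simp only: killed_iterates_linear)
        also have "\<dots> \<le> (1 / (2 * s)) * (W * (?S / c)) + (s / 2) * ?S"
          using Q s by (intro add_right_mono mult_left_mono) auto
        also have "\<dots> = \<delta> * ?S" using s c by (simp add: \<delta>_def field_simps)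
        finally show ?thesis by (simp only: killed_iterates_linear)
      qed
      \<comment> \<open>The Markov property at the restart time. The inner iterate, over the last
        \<open>k\<close> steps, is nonpositive at every survivor.\<close>
      have "(R ^^ N) (\<lambda>z. 1 * \<bar>z - ?p\<bar> + (- \<delta>) * 1) m\<^sub>0 =
          (R ^^ (N - k)) ((R ^^ k) (\<lambda>z. 1 * \<bar>z - ?p\<bar> + (- \<delta>) * 1)) m\<^sub>0"
        using \<open>k \<le> N\<close> by (simp flip: comp_apply[of "R ^^ (N - k)"] funpow_add)
      also have "\<dots> \<le> (R ^^ (N - k)) (\<lambda>_. 0) m\<^sub>0"
        by (intro iterates_mono m\<^sub>0 dev)
      also have "\<dots> \<le> 0" using iterates_abs_le[of "\<lambda>_. 0" 0 m\<^sub>0 "N - k"] m\<^sub>0 by simp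
      finally show ?case by (simp only: h_def)
    qed
  qed
  then show ?thesis
    unfolding killed_mean_linear by (simp add: killed_mean_one \<delta>_def W_def)
qed

end

section \<open>Uniform approximation by the flow\<close>


lemma
  assumes "\<exists>L. L-lipschitz_on {0..1} f"
  shows abs_le_sup_norm: "x \<in> {0..1} \<Longrightarrow> \<bar>f x\<bar> \<le> sup_norm f"
    and lip_norm_bound: "x \<in> {0..1} \<Longrightarrow> y \<in> {0..1} \<Longrightarrow> \<bar>f x - f y\<bar> \<le> lip_norm f * \<bar>x - y\<bar>"
    and sup_norm_nonneg: "0 \<le> sup_norm f"
    and lip_norm_nonneg: "0 \<le> lip_norm f"
proof -
  obtain L where L: "L-lipschitz_on {0..1} f" using assms by blast
  have "continuous_on {0..1} (\<lambda>x. \<bar>f x\<bar>)"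
    using lipschitz_on_continuous_on[OF L] by (intro continuous_intros)
  then have "bdd_above ((\<lambda>x. \<bar>f x\<bar>) ` {0..1})"
    by (intro bounded_imp_bdd_above compact_imp_bounded compact_continuous_image) auto
  then have sup: "\<bar>f x\<bar> \<le> sup_norm f" if "x \<in> {0..1}" for x
    unfolding sup_norm_def using that by (intro cSUP_upper)
  then show "x \<in> {0..1} \<Longrightarrow> \<bar>f x\<bar> \<le> sup_norm f" .
  show "0 \<le> sup_norm f" using sup[of 0] by simp
  show "0 \<le> lip_norm f"
    unfolding lip_norm_def using L by (intro cInf_greatest) (auto dest: lipschitz_on_nonneg)
  show "\<bar>f x - f y\<bar> \<le> lip_norm f * \<bar>x - y\<bar>" if xy: "x \<in> {0..1}" "y \<in> {0..1}"
  proof (cases "x = y")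
    case False
    have "\<bar>f x - f y\<bar> / \<bar>x - y\<bar> \<le> lip_norm f"
      unfolding lip_norm_def
    proof (rule cInf_greatest)
      fix L' assume "L' \<in> {L. L-lipschitz_on {0..1} f}"
      then show "\<bar>f x - f y\<bar> / \<bar>x - y\<bar> \<le> L'"
        using lipschitz_onD[of L' "{0..1}" f x y] xy False by (simp add: dist_real_def divide_le_eq)
    qed (use L in auto)
    then show ?thesis using False by (simp add: divide_le_eq)
  qed simp
qed

lemma drift_lip_pos: "\<beta> > 0 \<Longrightarrow> 0 < drift_lip \<beta>"
  by (auto simp: drift_lip_def intro!: add_pos_pos)

text \<open>The difference of the rates is \<open>n / 2\<close> times the drift, and the downward
  rate is at most \<open>n\<close>. So a drift of at least \<open>b\<close> exceeds the downward
  rate by a fraction \<open>b / 2\<close> of it.\<close>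

lemma rate_plus_ge_of_drift_ge:
  assumes "\<beta> > 1" "0 < \<epsilon>" "b > 0" "n \<ge> 1"
    and drift: "\<And>x. x \<in> {\<epsilon>..\<eta>} \<Longrightarrow> b \<le> cw_drift \<beta> x" and x: "x \<in> {\<epsilon>..\<eta>}" "x \<le> 1"
  shows "(1 + b / 2) * rate_minus \<beta> n x \<le> rate_plus \<beta> n x"
proof -
  have "rate_minus \<beta> n x = real n / 2 * ((1 + x) * exp (- \<beta> * x))"
    by (simp add: rate_minus_def)
  also have "\<dots> \<le> real n / 2 * 2"
    using down_weight_le[of \<beta> x] assms by (intro mult_left_mono) auto
  finally have "b / 2 * rate_minus \<beta> n x \<le> b / 2 * real n"
    using assms by (intro mult_left_mono) auto
  moreover have "rate_plus \<beta> n x - rate_minus \<beta> n x = real n / 2 * cw_drift \<beta> x"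
    by (simp add: rate_plus_def rate_minus_def cw_drift_def field_simps)
  moreover have "real n / 2 * b \<le> real n / 2 * cw_drift \<beta> x"
    using drift[OF x(1)] by (intro mult_left_mono) auto
  ultimately show ?thesis by (simp add: algebra_simps)
qed

context cw_conditioned
begin

lemma event_expectation_eq: "event_expectation M (\<lambda>\<omega>. f (X t \<omega>)) survives = killed_mean f / prob survives"
  unfolding event_expectation_def killed_mean_def set_lebesgue_integral_def by (simp add: mult.commute)

text \<open>Disposes of the finitely many small \<open>n\<close> for which survival is not yet under
  control.\<close>

lemma trivial_bound:
  assumes f: "\<exists>L. L-lipschitz_on {0..1} f"
  shows "\<bar>killed_mean f / prob survives - f (\<mu> t)\<bar> \<le> 2 * sup_norm f"
proof -
  have "killed_mean f \<le> sup_norm f * prob survives" "killed_mean (\<lambda>z. - 1 * f z + 0 * f z) \<le> sup_norm f * prob survives"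
    unfolding killed_mean_const[symmetric]
    using abs_le_sup_norm[OF f survivor_range] by (auto intro!: killed_mean_mono simp: abs_le_iff)
  then have "\<bar>killed_mean f\<bar> \<le> sup_norm f * prob survives"
    unfolding killed_mean_linear by (simp add: abs_le_iff)
  \<comment> \<open>If survival has probability 0, the quotient is 0 by convention and the bound
    still holds.\<close>
  then have "\<bar>killed_mean f / prob survives\<bar> \<le> sup_norm f"
    using sup_norm_nonneg[OF f] by (cases "prob survives = 0") (auto simp: divide_le_eq)
  then show ?thesis using abs_le_sup_norm[OF f flow_range01[OF t]] by linarith
qed

lemma lipschitz_bound:
  assumes f: "\<exists>L. L-lipschitz_on {0..1} f" and "0 < prob survives"
    and dev: "killed_mean (\<lambda>z. \<bar>z - \<mu> t\<bar>) \<le> \<delta> * prob survives"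
  shows "\<bar>killed_mean f / prob survives - f (\<mu> t)\<bar> \<le> lip_norm f * \<delta>"
proof -
  have abs: "\<bar>f z - f (\<mu> t)\<bar> \<le> lip_norm f * \<bar>z - \<mu> t\<bar>" if "z \<in> survivors \<epsilon> n" for z
    using lip_norm_bound[OF f survivor_range[OF that] flow_range01[OF t]] .
  have "killed_mean (\<lambda>z. 1 * f z + (- f (\<mu> t)) * 1) \<le> killed_mean (\<lambda>z. lip_norm f * \<bar>z - \<mu> t\<bar> + 0 * 1)"
    "killed_mean (\<lambda>z. (- 1) * f z + f (\<mu> t) * 1) \<le> killed_mean (\<lambda>z. lip_norm f * \<bar>z - \<mu> t\<bar> + 0 * 1)"
    using abs by (intro killed_mean_mono; fastforce simp: abs_le_iff)+
  then have "\<bar>killed_mean f - f (\<mu> t) * prob survives\<bar> \<le> lip_norm f * killed_mean (\<lambda>z. \<bar>z - \<mu> t\<bar>)"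
    unfolding killed_mean_linear by (simp add: killed_mean_one abs_le_iff)
  also have "\<dots> \<le> lip_norm f * (\<delta> * prob survives)"
    by (intro mult_left_mono dev lip_norm_nonneg[OF f])
  finally have "\<bar>killed_mean f - f (\<mu> t) * prob survives\<bar> / prob survives \<le> lip_norm f * \<delta>"
    using assms(2) by (simp add: divide_le_eq mult.assoc)
  moreover have "killed_mean f / prob survives - f (\<mu> t) = (killed_mean f - f (\<mu> t) * prob survives) / prob survives"
    using assms(2) by (simp add: field_simps)
  ultimately show ?thesis using assms(2) by simp
qed

end

text \<open>Stated outside the locale because the constants have to be chosen before
  \<open>n\<close>, the starting point, the time and the process.\<close>

lemma uniform_deviation:
  fixes \<beta> \<epsilon> \<eta> :: real
  assumes \<beta>: "\<beta> > 1" and \<epsilon>: "0 < \<epsilon>" "\<epsilon> < m_plus \<beta>" "\<epsilon> \<notin> \<rat>" and \<eta>: "\<epsilon> < \<eta>" "\<eta> < m_plus \<beta>"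
  obtains C \<alpha> :: real and n\<^sub>0 :: nat where "C > 0" "\<alpha> > 0"
    "\<And>(M :: 'a measure) X n m\<^sub>0 t \<mu>. n\<^sub>0 \<le> n \<Longrightarrow> cw_conditioned M X \<beta> n m\<^sub>0 \<epsilon> t \<mu> \<Longrightarrow>
      0 < measure M (cw_conditioned.survives M X \<epsilon> t) \<and>
      cw_conditioned.killed_mean M X \<epsilon> t (\<lambda>z. \<bar>z - \<mu> t\<bar>) \<le>
        C * real n powr - \<alpha> * measure M (cw_conditioned.survives M X \<epsilon> t)"
proof -
  define p where "p = m_plus \<beta>"
  define B where "B = drift_bound \<beta>"
  define K where "K = drift_lip \<beta>"
  have B: "0 < B" by (simp add: B_def drift_bound_def add_pos_pos)
  have K: "0 < K" using drift_lip_pos[of \<beta>] \<beta> by (simp add: K_def)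
  have p: "0 < p" "p < 1" using m_plus_pos m_plus_less_1 \<beta> by (auto simp: p_def)
  obtain a where a: "a > 0" and
    contr: "\<And>x. x \<in> {\<epsilon>..1} \<Longrightarrow> (x - p) * cw_drift \<beta> x \<le> - a * (x - p)\<^sup>2"
    using cw_drift_contracts[OF \<beta> \<epsilon>(1,2)] unfolding p_def by blast
  \<comment> \<open>On the strip between \<epsilon> and \<eta>, contraction bounds the drift below
    by \<open>a\<close> times the distance to \<open>p\<close>, which is smallest at \<eta>.\<close>
  define b where "b = a * (p - \<eta>)"
  have b: "b > 0" using a \<eta> by (simp add: b_def p_def)
  have drift: "b \<le> cw_drift \<beta> x" if "x \<in> {\<epsilon>..\<eta>}" for x
  proof -
    have "x < p" using that \<eta> by (simp add: p_def)
    have "(p - x) * (a * (p - x)) \<le> (p - x) * cw_drift \<beta> x"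
      using contr[of x] that \<open>x < p\<close> p by (simp add: power2_eq_square algebra_simps)
    then have "a * (p - x) \<le> cw_drift \<beta> x" using \<open>x < p\<close> by simp
    moreover have "a * (p - \<eta>) \<le> a * (p - x)" using that a by simp
    ultimately show ?thesis by (simp add: b_def)
  qed
  define \<theta> where "\<theta> = 1 + b / 2"
  have \<theta>: "\<theta> > 1" using b by (simp add: \<theta>_def)
  \<comment> \<open>Half of the ruin bound; the other half absorbs the loss
    \<open>(T n + 1) * \<kappa> n\<close>, which tends to 0 because \<kappa> decays exponentially
    while \<open>T\<close> is logarithmic.\<close>
  define c where "c = (1 - 1 / \<theta>) / 2"
  have c: "c > 0" using \<theta> by (simp add: c_def)
  \<comment> \<open>The slower of the two rates for second moments; \<alpha> is half of it because
    first moments are estimated.\<close>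
  define \<gamma> where "\<gamma> = min (1 / 2) (2 * a * (1 / (4 * K)))"
  define \<alpha> where "\<alpha> = \<gamma> / 2"
  have \<gamma>: "0 < \<gamma>" "\<gamma> \<le> 1 / 2" "\<gamma> \<le> 2 * a * (1 / (4 * K))" using a K by (auto simp: \<gamma>_def)
  define T where "T n = 1 / (4 * K) * ln (real n)" for n :: nat
  define \<kappa> where "\<kappa> n = (\<theta> - 1) * real n * \<theta> powr (- (real n * (\<eta> - \<epsilon>) / 2))" for n :: nat
  \<comment> \<open>One constant for both time ranges: \<open>B / K\<close> stems from tracking,
    \<open>1 + B / a\<close> from relaxation, and 2 covers the Young term and the distance of the
    flow from \<open>p\<close>.\<close>
  define C where "C = (B / K + 1 + B / a) / c + 2"
  have C: "C > 0" using B K a c by (simp add: C_def add_pos_pos)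
  have "(\<lambda>n. (T n + 1) * \<kappa> n) \<longlonglongrightarrow> 0"
    unfolding T_def \<kappa>_def using K \<theta> \<eta> by real_asymp
  then have "\<forall>\<^sub>F n in sequentially. (T n + 1) * \<kappa> n < c"
    using c by (rule order_tendstoD)
  then obtain n\<^sub>0 where n\<^sub>0: "\<And>n. n\<^sub>0 \<le> n \<Longrightarrow> (T n + 1) * \<kappa> n < c"
    unfolding eventually_sequentially by blast
  show ?thesis
  proof (rule that[of C \<alpha> n\<^sub>0])
    show "C > 0" "\<alpha> > 0" using C \<gamma> by (auto simp: \<alpha>_def)
    fix M :: "'a measure" and X n m\<^sub>0 t \<mu>
    assume large: "n\<^sub>0 \<le> n" and "cw_conditioned M X \<beta> n m\<^sub>0 \<epsilon> t \<mu>"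
    then interpret cw_conditioned M X \<beta> n m\<^sub>0 \<epsilon> t \<mu> by simp
    note n1 = n
    \<comment> \<open>The parameter for Young's inequality; its square is the order of the second
      moments, which balances the two terms.\<close>
    define s where "s = real n powr - \<alpha>"
    have s: "0 < s" using n1 by (simp add: s_def)
    have s2: "real n powr - \<gamma> = s * s" by (simp add: s_def \<alpha>_def flip: powr_add)
    have T: "0 \<le> T n" using n1 K by (simp add: T_def)
    have exp_T: "exp (r * T n) = real n powr (r * (1 / (4 * K)))" for r
      using n1 by (simp add: powr_def T_def)
    have \<kappa>: "0 \<le> \<kappa> n" using \<theta> by (simp add: \<kappa>_def)
    have ratio: "\<theta> * rate_minus \<beta> n x \<le> rate_plus \<beta> n x" if "x \<in> {\<epsilon>..\<eta>}" for x
      unfolding \<theta>_def using that \<eta> p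
      by (intro rate_plus_ge_of_drift_ge[OF \<beta> \<epsilon>(1) b n1 drift that]) (auto simp: p_def)
    consider "t = 0" | "0 < t" "t \<le> T n" | "T n < t" using t by linarith
    then show "0 < prob survives \<and> killed_mean (\<lambda>z. \<bar>z - \<mu> t\<bar>) \<le> C * real n powr - \<alpha> * prob survives"
    proof cases
      case 1
      \<comment> \<open>At time 0 the mesh is 0, outside the range of the step estimates, but then
        each step is the identity.\<close>
      have id: "(killed_step (E n) (survivors \<epsilon> n) (cw_rates \<beta> n) (t / real N) ^^ N) g m\<^sub>0 = g m\<^sub>0" for N g
      proof -
        have "killed_step (E n) (survivors \<epsilon> n) (cw_rates \<beta> n) (t / real N) = id"
          using 1 by (auto simp: killed_step_def fun_eq_iff)
        then show ?thesis by simp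
      qed
      have mean: "killed_mean g = g m\<^sub>0" for g
        using step_limit[of g] unfolding id by (simp add: LIMSEQ_const_iff)
      have "\<mu> t = m\<^sub>0" using flow 1 by (simp add: cw_flow_def)
      then show ?thesis using mean[of "\<lambda>_. 1"] mean[of "\<lambda>z. \<bar>z - m\<^sub>0\<bar>"] C s by (simp add: killed_mean_one s_def)
    next
      case 2
      have "t * \<kappa> n \<le> (T n + 1) * \<kappa> n" using 2 \<kappa> by (intro mult_right_mono) auto
      moreover have "2 * c = 1 - 1 / \<theta>" by (simp add: c_def)
      ultimately have P: "c \<le> prob survives"
        using short_time(2)[where \<eta> = \<eta>, OF 2(1) \<theta> ratio] n\<^sub>0[OF large]
        unfolding \<kappa>_def[symmetric] by linarith
      have "killed_mean (\<lambda>z. (z - \<mu> t)\<^sup>2) \<le> B / (K * n) * exp (2 * K * t)"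
        using short_time(1)[where \<eta> = \<eta>, OF 2(1) \<theta> ratio] by (simp add: B_def K_def)
      also have "\<dots> \<le> B / (K * n) * exp (2 * K * T n)"
        using 2 B K by (intro mult_left_mono) auto
      also have "\<dots> = B / K * real n powr - (1 / 2)"
        using n1 K unfolding exp_T by (simp add: powr_minus_divide powr_half_sqrt real_div_sqrt field_simps flip: real_sqrt_mult)
      also have "\<dots> \<le> B / K * real n powr - \<gamma>"
        using B K \<gamma> n1 by (intro mult_left_mono powr_mono) auto
      finally have sq: "killed_mean (\<lambda>z. (z - \<mu> t)\<^sup>2) \<le> B / K * (s * s)" by (simp add: s2)
      \<comment> \<open>As for long times, the error is rewritten as a multiple of the survival
        probability, here directly from its lower bound \<open>c\<close>.\<close>
      have base: "B / K * s * 1 \<le> B / K * s * (prob survives / c)"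
        using P B K s c by (intro mult_left_mono) auto
      have "killed_mean (\<lambda>z. \<bar>z - \<mu> t\<bar>) \<le> (killed_mean (\<lambda>z. (z - \<mu> t)\<^sup>2) / s + s * prob survives) / 2"
        by (rule killed_mean_abs_le[OF s])
      also have "\<dots> \<le> (B / K * (s * s) / s + s * prob survives) / 2"
        using sq s by (intro divide_right_mono add_right_mono) auto
      also have "\<dots> = (B / K * s * 1 + s * prob survives) / 2" using s by simp
      also have "\<dots> \<le> (B / K * s * (prob survives / c) + s * prob survives) / 2"
        by (intro divide_right_mono add_right_mono base) simp
      also have "\<dots> = ((B / K / c + 1) / 2) * s * prob survives" by (simp add: field_simps)
      also have "\<dots> \<le> C * s * prob survives"
      proof (intro mult_right_mono)
        define x where "x = B / K / c"
        define y where "y = (1 + B / a) / c"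
        have "0 \<le> x" "0 \<le> y" using B K c a by (auto simp: x_def y_def)
        moreover have "C = x + y + 2" by (simp add: C_def x_def y_def add_divide_distrib)
        ultimately have "(x + 1) / 2 \<le> C" by simp
        then show "(B / K / c + 1) / 2 \<le> C" by (simp only: x_def)
      qed (use s in auto)
      finally show ?thesis using P c by (simp add: s_def)
    next
      case 3
      have c_le: "c \<le> 1 - 1 / \<theta> - (T n + 1) * \<kappa> n" using n\<^sub>0[OF large] by (simp add: c_def field_simps)
      have "exp (- 2 * a * T n) \<le> real n powr - \<gamma>"
        unfolding exp_T using \<gamma> n1 by (intro powr_mono) auto
      moreover have "B / (a * n) \<le> B / a * real n powr - \<gamma>"
      proof -
        have "B / (a * n) = B / a * real n powr - 1" using n1 by (simp add: powr_minus_divide)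
        also have "\<dots> \<le> B / a * real n powr - \<gamma>"
          using B a \<gamma> n1 by (intro mult_left_mono powr_mono) auto
        finally show ?thesis .
      qed
      ultimately have W: "exp (- 2 * a * T n) + B / (a * n) \<le> (1 + B / a) * (s * s)"
        unfolding s2 by (simp add: distrib_right)
      have "killed_mean (\<lambda>z. \<bar>z - p\<bar>) \<le> ((exp (- 2 * a * T n) + B / (a * n)) / (s * c) + s) / 2 * prob survives"
        unfolding p_def B_def
        by (rule long_time[OF T 3 \<theta> ratio a contr[unfolded p_def] c c_le[unfolded \<kappa>_def] s])
      also have "\<dots> \<le> ((1 + B / a) * (s * s) / (s * c) + s) / 2 * prob survives"
        using W s c by (intro mult_right_mono divide_right_mono add_right_mono) auto
      also have "\<dots> = (((1 + B / a) / c + 1) / 2) * s * prob survives" using s c by (simp add: field_simps)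
      finally have dev: "killed_mean (\<lambda>z. \<bar>z - p\<bar>) \<le> (((1 + B / a) / c + 1) / 2) * s * prob survives" .
      have "(m\<^sub>0 - p)\<^sup>2 \<le> 1"
        using survivor_range[OF m\<^sub>0] p by (simp add: abs_square_le_1 abs_le_iff)
      have "(\<mu> t - p)\<^sup>2 \<le> exp (- 2 * a * t) * (m\<^sub>0 - p)\<^sup>2"
        by (rule cw_flow_converges[OF flow flow_range contr t])
      also have "\<dots> \<le> exp (- 2 * a * T n) * 1"
        using 3 a \<open>(m\<^sub>0 - p)\<^sup>2 \<le> 1\<close> by (intro mult_mono) auto
      also have "\<dots> \<le> s\<^sup>2"
        using \<open>exp (- 2 * a * T n) \<le> real n powr - \<gamma>\<close> by (simp add: s2 power2_eq_square)
      finally have flow_close: "\<bar>\<mu> t - p\<bar> \<le> s" using s by (simp add: abs_le_square_iff[symmetric])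
      have "killed_mean (\<lambda>z. \<bar>z - \<mu> t\<bar>) \<le> killed_mean (\<lambda>z. 1 * \<bar>z - p\<bar> + s * 1)"
      proof (rule killed_mean_mono)
        fix z
        have "\<bar>z - \<mu> t\<bar> \<le> \<bar>z - p\<bar> + \<bar>p - \<mu> t\<bar>"
          using abs_triangle_ineq[of "z - p" "p - \<mu> t"] by simp
        then show "\<bar>z - \<mu> t\<bar> \<le> 1 * \<bar>z - p\<bar> + s * 1"
          using flow_close by (simp add: abs_minus_commute)
      qed
      also have "\<dots> = killed_mean (\<lambda>z. \<bar>z - p\<bar>) + s * prob survives" unfolding killed_mean_linear by (simp add: killed_mean_one)
      also have "\<dots> \<le> (((1 + B / a) / c + 1) / 2 + 1) * s * prob survives"
        using dev by (simp add: distrib_right)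
      also have "\<dots> \<le> C * s * prob survives"
      proof (intro mult_right_mono)
        define x where "x = B / K / c"
        define y where "y = (1 + B / a) / c"
        have "0 \<le> x" "0 \<le> y" using B K c a by (auto simp: x_def y_def)
        moreover have "C = x + y + 2" by (simp add: C_def x_def y_def add_divide_distrib)
        ultimately have "(y + 1) / 2 + 1 \<le> C" by simp
        then show "((1 + B / a) / c + 1) / 2 + 1 \<le> C" by (simp only: y_def)
      qed (use s in auto)
      finally show ?thesis using prob_survives_pos T 3 by (simp add: s_def)
    qed
  qed
qed

theorem theorem2:
  fixes \<beta> \<epsilon> \<eta> :: real
  assumes "\<beta> > 1"
    and "0 < \<epsilon>" and "\<epsilon> < m_plus \<beta>" and "\<epsilon> \<notin> \<rat>"
    and "\<epsilon> < \<eta>" and "\<eta> < m_plus \<beta>"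
  shows "\<exists>C \<alpha> :: real. C > 0 \<and> \<alpha> > 0 \<and>
    (\<forall>n::nat. n \<ge> 1 \<longrightarrow>
      (\<forall>f :: real \<Rightarrow> real. (\<exists>L. L-lipschitz_on {0..1} f) \<longrightarrow>
        (\<forall>m\<^sub>0 \<in> E n \<inter> {\<epsilon>..1} \<inter> {\<eta>..1}.
          \<forall>(M :: 'a measure) m \<mu>.
            magnetization_process M m \<beta> n m\<^sub>0 \<longrightarrow> cw_flow \<beta> m\<^sub>0 \<mu> \<longrightarrow>
            (SUP t\<in>{0..}. ereal \<bar>event_expectation M (\<lambda>\<omega>. f (m t \<omega>))
                {\<omega> \<in> space M. hitting_time_below m \<epsilon> \<omega> > ereal t} - f (\<mu> t)\<bar>)
              \<le> ereal (C * ((sup_norm f + lip_norm f) / real n powr \<alpha>)))))"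
proof -
  obtain C\<^sub>0 \<alpha> :: real and n\<^sub>0 :: nat where C\<^sub>0: "C\<^sub>0 > 0" and \<alpha>: "\<alpha> > 0"
    and main: "\<And>(M :: 'a measure) X n m\<^sub>0 t \<mu>. n\<^sub>0 \<le> n \<Longrightarrow> cw_conditioned M X \<beta> n m\<^sub>0 \<epsilon> t \<mu> \<Longrightarrow>
      0 < measure M (cw_conditioned.survives M X \<epsilon> t) \<and>
      cw_conditioned.killed_mean M X \<epsilon> t (\<lambda>z. \<bar>z - \<mu> t\<bar>) \<le>
        C\<^sub>0 * real n powr - \<alpha> * measure M (cw_conditioned.survives M X \<epsilon> t)"
    using uniform_deviation[OF assms] by blast
  \<comment> \<open>The second summand makes \<open>C / n powr \<alpha>\<close> at least 2 for all
    \<open>n\<close> below \<open>n\<^sub>0\<close>, where the trivial bound is used.\<close>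
  define C where "C = C\<^sub>0 + 2 * real n\<^sub>0 powr \<alpha>"
  show ?thesis
  proof (rule exI[of _ C], rule exI[of _ \<alpha>], intro conjI allI impI ballI SUP_least)
    show "C > 0" using C\<^sub>0 by (simp add: C_def add_pos_nonneg)
    show "\<alpha> > 0" by (rule \<alpha>)
    fix n :: nat and f :: "real \<Rightarrow> real" and m\<^sub>0 and M :: "'a measure" and m \<mu> and t :: real
    assume n: "n \<ge> 1" and f: "\<exists>L. L-lipschitz_on {0..1} f"
      and m\<^sub>0: "m\<^sub>0 \<in> E n \<inter> {\<epsilon>..1} \<inter> {\<eta>..1}"
      and process: "magnetization_process M m \<beta> n m\<^sub>0" and flow: "cw_flow \<beta> m\<^sub>0 \<mu>" and t: "t \<in> {0..}"
    interpret jump_chain M m "E n" "cw_rates \<beta> n" m\<^sub>0 by (rule process)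
    interpret cw_conditioned M m \<beta> n m\<^sub>0 \<epsilon> t \<mu>
      by unfold_locales (use assms n m\<^sub>0 flow t in \<open>auto simp: survivors_def\<close>)
    have norms: "0 \<le> sup_norm f" "0 \<le> lip_norm f" using sup_norm_nonneg[OF f] lip_norm_nonneg[OF f] by auto
    have "\<bar>killed_mean f / prob survives - f (\<mu> t)\<bar> \<le> C * ((sup_norm f + lip_norm f) / real n powr \<alpha>)"
    proof (cases "n\<^sub>0 \<le> n")
      case True
      have dev: "0 < prob survives" "killed_mean (\<lambda>z. \<bar>z - \<mu> t\<bar>) \<le> C\<^sub>0 * real n powr - \<alpha> * prob survives"
        using main[OF True cw_conditioned_axioms] by auto
      have "\<bar>killed_mean f / prob survives - f (\<mu> t)\<bar> \<le> lip_norm f * (C\<^sub>0 * real n powr - \<alpha>)"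
        by (rule lipschitz_bound[OF f dev])
      also have "\<dots> = C\<^sub>0 * (lip_norm f / real n powr \<alpha>)" by (simp add: powr_minus_divide)
      also have "\<dots> \<le> C * ((sup_norm f + lip_norm f) / real n powr \<alpha>)"
        using norms C\<^sub>0 by (intro mult_mono divide_right_mono) (auto simp: C_def)
      finally show ?thesis .
    next
      case False
      have "real n powr \<alpha> \<le> real n\<^sub>0 powr \<alpha>" using False \<alpha> by (intro powr_mono2) auto
      then have "2 \<le> C / real n powr \<alpha>"
        using n C\<^sub>0 by (simp add: C_def le_divide_eq)
      then have "2 * sup_norm f \<le> C / real n powr \<alpha> * (sup_norm f + lip_norm f)"
        using norms by (intro mult_mono) auto
      then show ?thesis using trivial_bound[OF f] by simp
    qed
    then show "ereal \<bar>event_expectation M (\<lambda>\<omega>. f (m t \<omega>))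
        {\<omega> \<in> space M. hitting_time_below m \<epsilon> \<omega> > ereal t} - f (\<mu> t)\<bar>
      \<le> ereal (C * ((sup_norm f + lip_norm f) / real n powr \<alpha>))"
      using event_expectation_eq[of f] by (simp add: survives_def)
  qed
qed

end
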